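(* Let $p\ge 5$ be a prime and let $a$ be a $p$-adic integer such that $\langle a\rangle_p$ is even. Then $$\sum_{k=0}^{p-1}\frac{(\tfrac12)_k\,(-a)_k\,(a+1)_k}{(1)_k\,(1)_k}\cdot\frac{1}{k!}\equiv(-1)^{\frac{p+1}{2}}\,\Gamma_p\!\left(-\tfrac{a}{2}\right)^2\Gamma_p\!\left(\tfrac{a+1}{2}\right)^2\pmod{p^2}.$$ (The left-hand side is the truncated hypergeometric series ${}_3F_2\!\left(\tfrac12,-a,a+1;\,1,1;\,1\right)_{p-1}$.)
   Context: For a number $x$, the Pochhammer symbol is $(x)_0=1$ and $(x)_k=x(x+1)\cdots(x+k-1)$ for $k\ge1$. For a $p$-adic integer $a$, $\langle a\rangle_p$ denotes the least non-negative integer $r$ with $a\equiv r\pmod p$. $\Gamma_p$ is Morita's $p$-adic Gamma function: for $x\in\mathbb{Z}_p$, $\Gamma_p(x)=\lim_{m\to x}(-1)^m\prod_{0<k<m,\ (k,p)=1}k$, the limit taken over non-negative integers $m$ tending to $x$ $p$-adically. Congruences modulo $p^2$ are in $\mathbb{Z}_p$. *)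

theory Defs
  imports Complex_Main "Berlekamp_Zassenhaus.Finite_Field"
begin

text \<open>
  The ring $\mathbb{Z}_p = \varprojlim \mathbb{Z}/p^n$, where the prime $p$ is the cardinality of the
  index type \<open>'p\<close>. An element is its coherent sequence of least non-negative residues
  modulo $p^0, p^1, p^2, \ldots$
\<close>

typedef (overloaded) ('p :: prime_card) padic_int =
  "{x :: nat \<Rightarrow> int. (\<forall>n. x n \<in> {0..<int CARD('p) ^ n}) \<and>
     (\<forall>n. x (Suc n) mod int CARD('p) ^ n = x n)}"
  morphisms padic_mod Abs_padic_int
  by (rule exI[of _ "\<lambda>_. 0"])
    (use prime_gt_0_nat[OF prime_card[where 'a = 'p]] in auto)

setup_lifting type_definition_padic_int

lemma card_prime_pos: "0 < int CARD('p :: prime_card)"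
  using prime_gt_0_nat[OF prime_card[where 'a = 'p]] by simp

lemma mod_power_Suc_mod_power: "(x :: int) mod b ^ Suc n mod b ^ n = x mod b ^ n"
  by (simp add: mod_mod_cancel)

lemma padic_coherent:
  assumes "\<And>n. f (Suc n) mod int CARD('p :: prime_card) ^ n = f n mod int CARD('p) ^ n"
  shows "(\<forall>n. f n mod int CARD('p) ^ n \<in> {0..<int CARD('p) ^ n}) \<and>
    (\<forall>n. f (Suc n) mod int CARD('p) ^ Suc n mod int CARD('p) ^ n = f n mod int CARD('p) ^ n)"
  using assms card_prime_pos[where 'p = 'p] by (simp only: mod_power_Suc_mod_power) auto

instantiation padic_int :: (prime_card) comm_ring_1
begin

lift_definition zero_padic_int :: "'a padic_int" is "\<lambda>n. 0 mod int CARD('a) ^ n"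
  by (rule padic_coherent) simp

lift_definition one_padic_int :: "'a padic_int" is "\<lambda>n. 1 mod int CARD('a) ^ n"
  by (rule padic_coherent) simp

lift_definition plus_padic_int :: "'a padic_int \<Rightarrow> 'a padic_int \<Rightarrow> 'a padic_int"
  is "\<lambda>x y n. (x n + y n) mod int CARD('a) ^ n"
  by (rule padic_coherent) (metis mod_add_eq mod_mod_trivial)

lift_definition minus_padic_int :: "'a padic_int \<Rightarrow> 'a padic_int \<Rightarrow> 'a padic_int"
  is "\<lambda>x y n. (x n - y n) mod int CARD('a) ^ n"
  by (rule padic_coherent) (metis mod_diff_eq mod_mod_trivial)

lift_definition uminus_padic_int :: "'a padic_int \<Rightarrow> 'a padic_int"
  is "\<lambda>x n. (- x n) mod int CARD('a) ^ n"
  by (rule padic_coherent) (metis mod_minus_eq mod_mod_trivial)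

lift_definition times_padic_int :: "'a padic_int \<Rightarrow> 'a padic_int \<Rightarrow> 'a padic_int"
  is "\<lambda>x y n. (x n * y n) mod int CARD('a) ^ n"
  by (rule padic_coherent) (metis mod_mult_eq mod_mod_trivial)

instance
proof
  show "(0 :: 'a padic_int) \<noteq> 1"
  proof
    assume "(0 :: 'a padic_int) = 1"
    then have "padic_mod (0 :: 'a padic_int) 1 = padic_mod 1 1" by simp
    then show False
      using prime_gt_1_nat[OF prime_card[where 'a = 'a]]
      by (simp add: zero_padic_int.rep_eq one_padic_int.rep_eq)
  qed
qed (transfer; auto simp: fun_eq_iff mod_simps algebra_simps)+

end

lemma padic_mod_of_nat:
  "padic_mod (of_nat m :: 'p :: prime_card padic_int) n = int m mod int CARD('p) ^ n"
  by (induction m)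
    (simp_all add: zero_padic_int.rep_eq one_padic_int.rep_eq plus_padic_int.rep_eq mod_simps)

lemma padic_mod_diff_eq_0_iff:
  "padic_mod (x - y) n = 0 \<longleftrightarrow> padic_mod x n = padic_mod (y :: 'p :: prime_card padic_int) n"
proof -
  have *: "padic_mod z n mod int CARD('p) ^ n = padic_mod z n" for z :: "'p padic_int"
    using padic_mod[of z] by (auto intro: mod_pos_pos_trivial)
  have "padic_mod (x - y) n = 0 \<longleftrightarrow>
      padic_mod x n mod int CARD('p) ^ n = padic_mod y n mod int CARD('p) ^ n"
    by (simp add: minus_padic_int.rep_eq mod_eq_dvd_iff mod_eq_0_iff_dvd)
  then show ?thesis by (simp only: *)
qed

lemma padic_mod_eq_mono:
  fixes x y :: "'p :: prime_card padic_int"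
  assumes "padic_mod x n = padic_mod y n" "m \<le> n"
  shows "padic_mod x m = padic_mod y m"
  using assms(2,1)
proof (induction rule: dec_induct)
  case (step k)
  have *: "padic_mod z (Suc k) mod int CARD('p) ^ k = padic_mod z k" for z :: "'p padic_int"
    using padic_mod[of z] by auto
  have "padic_mod x k = padic_mod x (Suc k) mod int CARD('p) ^ k" by (rule *[symmetric])
  also have "\<dots> = padic_mod y (Suc k) mod int CARD('p) ^ k" by (simp only: step.prems)
  also have "\<dots> = padic_mod y k" by (rule *)
  finally have "padic_mod x k = padic_mod y k" .
  then show ?case by (rule step.IH)
qed

instance padic_int :: (prime_card) ring_char_0
proof
  show "inj (of_nat :: nat \<Rightarrow> 'a padic_int)"
  proof (rule injI)
    fix m n :: nat
    assume eq: "(of_nat m :: 'a padic_int) = of_nat n"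
    define k where "k = m + n"
    have "int k < int CARD('a) ^ k"
      using of_nat_less_iff[where 'a = int, THEN iffD2,
          OF less_exp[THEN less_le_trans, OF power_mono[of 2 "CARD('a)" k]]]
        prime_ge_2_nat[OF prime_card[where 'a = 'a]] by simp
    moreover have "int m mod int CARD('a) ^ k = int n mod int CARD('a) ^ k"
      using eq by (metis padic_mod_of_nat)
    moreover have "int m \<le> int k" "int n \<le> int k" by (simp_all add: k_def)
    ultimately show "m = n"
      using mod_pos_pos_trivial[of "int m" "int CARD('a) ^ k"]
        mod_pos_pos_trivial[of "int n" "int CARD('a) ^ k"] by linarith
  qed
qed

text \<open>
  Division is the quotient in the ring whenever the denominator is a unit of $\mathbb{Z}_p$
  (division by a non-unit yields 0).
\<close>

instantiation padic_int :: (prime_card) inverse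
begin

definition inverse_padic_int :: "'a padic_int \<Rightarrow> 'a padic_int" where
  "inverse (x :: 'a padic_int) = (if x dvd 1 then THE y. x * y = 1 else 0)"

definition divide_padic_int :: "'a padic_int \<Rightarrow> 'a padic_int \<Rightarrow> 'a padic_int" where
  "x div y = x * inverse (y :: 'a padic_int)"

instance ..

end

lemma padic_mult_inverse:
  assumes "(x :: 'p :: prime_card padic_int) dvd 1"
  shows "x * inverse x = 1"
proof -
  from assms obtain y where "1 = x * y" by (rule dvdE)
  then have y: "x * y = 1" by (rule sym)
  have uniq: "z = y" if "x * z = 1" for z
  proof -
    have "z = z * (x * y)" by (simp add: y)
    also have "\<dots> = (x * z) * y" by (simp add: mult_ac)
    finally show ?thesis by (simp add: that)
  qed
  have "(THE z. x * z = 1) = y" by (rule the_equality, rule y, rule uniq)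
  then show ?thesis using y assms by (simp add: inverse_padic_int_def)
qed

text \<open>
  \<open>padic_val x\<close> is the largest \<open>n\<close> with \<open>x \<equiv> 0\<close> modulo $p^n$, for \<open>x \<noteq> 0\<close>.
\<close>

definition padic_val :: "'p :: prime_card padic_int \<Rightarrow> nat" where
  "padic_val x = (LEAST n. padic_mod x (Suc n) \<noteq> 0)"

definition padic_abs :: "'p :: prime_card padic_int \<Rightarrow> real" where
  "padic_abs x = (if x = 0 then 0 else 1 / real CARD('p) ^ padic_val x)"

lemma padic_eq_0_iff: "x = 0 \<longleftrightarrow> (\<forall>n. padic_mod (x :: 'p :: prime_card padic_int) (Suc n) = 0)"
proof
  assume *: "\<forall>n. padic_mod x (Suc n) = 0"
  have "padic_mod x n = padic_mod (0 :: 'p padic_int) n" for n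
    using padic_mod_eq_mono[of x "Suc n" 0 n] * by (simp add: zero_padic_int.rep_eq)
  then show "x = 0" by (simp add: padic_mod_inject[symmetric] fun_eq_iff)
qed (simp add: zero_padic_int.rep_eq)

lemma padic_abs_le_iff:
  "padic_abs (x :: 'p :: prime_card padic_int) \<le> 1 / real CARD('p) ^ n \<longleftrightarrow> padic_mod x n = 0"
proof (cases "x = 0")
  case True
  then show ?thesis by (simp add: padic_abs_def zero_padic_int.rep_eq)
next
  case False
  have p: "1 < real CARD('p)" using prime_gt_1_nat[OF prime_card[where 'a = 'p]] by simp
  have nz: "padic_mod x (Suc (padic_val x)) \<noteq> 0"
    unfolding padic_val_def using False padic_eq_0_iff by (metis (mono_tags, lifting) LeastI_ex)
  have z: "padic_mod x m = 0" if "m \<le> padic_val x" for m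
  proof (cases m)
    case 0
    then show ?thesis using padic_mod[of x] by (auto dest: spec[of _ 0])
  next
    case (Suc k)
    then show ?thesis using that not_less_Least[of k "\<lambda>n. padic_mod x (Suc n) \<noteq> 0"]
      by (auto simp: padic_val_def)
  qed
  have "padic_mod x m \<noteq> 0" if "m > padic_val x" for m
    using padic_mod_eq_mono[of x m 0 "Suc (padic_val x)"] nz that
    by (auto simp: zero_padic_int.rep_eq)
  then have "padic_mod x n = 0 \<longleftrightarrow> n \<le> padic_val x"
    using z by (metis not_le)
  also have "\<dots> \<longleftrightarrow> real CARD('p) ^ n \<le> real CARD('p) ^ padic_val x"
    using p by simp
  also have "\<dots> \<longleftrightarrow> padic_abs x \<le> 1 / real CARD('p) ^ n"
    using p False by (simp add: padic_abs_def field_simps)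
  finally show ?thesis ..
qed

lemma padic_abs_nonneg: "0 \<le> padic_abs x"
  by (simp add: padic_abs_def)

lemma padic_abs_diff_ultrametric:
  "padic_abs (x - y) \<le> max (padic_abs (x - z)) (padic_abs (y - (z :: 'p :: prime_card padic_int)))"
proof -
  have aux: "padic_abs (u - v) \<le> padic_abs (u - w)"
    if le: "padic_abs (v - w) \<le> padic_abs (u - w)" for u v w :: "'p padic_int"
  proof (cases "u = w")
    case True
    with le have "padic_abs (v - w) = 0" using padic_abs_nonneg[of "v - w"] by (simp add: padic_abs_def)
    then have "v = w" by (auto simp: padic_abs_def split: if_splits)
    with True show ?thesis by simp
  next
    case False
    then have n: "padic_abs (u - w) = 1 / real CARD('p) ^ padic_val (u - w)"
      by (simp add: padic_abs_def)
    show ?thesis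
      using le padic_abs_le_iff[of "u - w" "padic_val (u - w)"]
      unfolding n padic_abs_le_iff padic_mod_diff_eq_0_iff by simp
  qed
  have sym: "padic_abs (u - v) = padic_abs (v - u)" for u v :: "'p padic_int"
  proof -
    have "padic_mod (u - v) n = 0 \<longleftrightarrow> padic_mod (v - u) n = 0" for n
      by (auto simp: padic_mod_diff_eq_0_iff)
    then show ?thesis by (auto simp: padic_abs_def padic_val_def)
  qed
  show ?thesis
    using aux[of y z x] aux[of x z y] sym[of x y] by (auto simp: max_def)
qed

instantiation padic_int :: (prime_card) metric_space
begin

definition dist_padic_int :: "'a padic_int \<Rightarrow> 'a padic_int \<Rightarrow> real" where
  "dist (x :: 'a padic_int) y = padic_abs (x - y)"

definition uniformity_padic_int :: "('a padic_int \<times> 'a padic_int) filter" where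
  "uniformity = (INF e\<in>{0<..}. principal {(x, y). dist x (y :: 'a padic_int) < e})"

definition open_padic_int :: "'a padic_int set \<Rightarrow> bool" where
  "open (U :: 'a padic_int set) \<longleftrightarrow> (\<forall>x\<in>U. \<forall>\<^sub>F (x', y) in uniformity. x' = x \<longrightarrow> y \<in> U)"

instance
proof
  fix x y z :: "'a padic_int"
  show "dist x y = 0 \<longleftrightarrow> x = y" by (simp add: dist_padic_int_def padic_abs_def)
  show "dist x y \<le> dist x z + dist y z"
    using padic_abs_diff_ultrametric[of x y z] padic_abs_nonneg[of "x - z"] padic_abs_nonneg[of "y - z"]
    by (simp add: dist_padic_int_def)
qed (simp_all only: uniformity_padic_int_def open_padic_int_def)

end

definition padic_residue :: "'p :: prime_card padic_int \<Rightarrow> nat" where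
  "padic_residue a = (LEAST r. of_nat CARD('p) dvd a - of_nat r)"

text \<open>
  Morita's $\Gamma_p$. The limit is along natural numbers \<open>m\<close> tending \<open>p\<close>-adically to \<open>x\<close>;
  \<open>m = x\<close> is admitted when \<open>x\<close> is itself a natural number.
\<close>

definition padic_Gamma :: "'p :: prime_card padic_int \<Rightarrow> 'p padic_int" where
  "padic_Gamma x = Lim (filtercomap of_nat (nhds x))
     (\<lambda>m::nat. (-1) ^ m * (\<Prod>k | 0 < k \<and> k < m \<and> coprime k CARD('p). of_nat k))"

end

theory Submission
  imports Defs "HOL-Number_Theory.Residues"
begin

text \<open>
  Both sides are functions of \<open>a\<close> that are affine in \<open>t\<close> modulo \<open>p\<^sup>2\<close> along every residue class
  \<open>a = x + p t\<close>: the left-hand side because it is a polynomial with \<open>p\<close>-integral coefficients, the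
  right-hand side because \<open>\<Gamma>\<^sub>p (x + p t)\<close> modulo \<open>p\<^sup>2\<close> is a geometric progression in \<open>t\<close> with ratio
  congruent to 1 modulo \<open>p\<close>. Both are also invariant under \<open>a \<mapsto> - 1 - a\<close>, which maps \<open>r - p\<close> to
  \<open>p - 1 - r\<close>. Hence agreement modulo \<open>p\<^sup>2\<close> at all even \<open>r\<close> in \<open>{0..p - 1}\<close> gives agreement at the two
  points \<open>r\<close> and \<open>r - p\<close> of the class of \<open>a\<close>, and therefore on the whole class. At \<open>r = 2 s\<close> the series
  terminates and equals \<open>((1/2)\<^sub>s / s!)\<^sup>2\<close>, and so does the other side by the functional equation of
  \<open>\<Gamma>\<^sub>p\<close> and \<open>\<Gamma>\<^sub>p (1/2)\<^sup>2 = (-1)\<^bsup>(p + 1) / 2\<^esup>\<close>.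
\<close>

section \<open>Morita's product over the integers\<close>

text \<open>The expression whose p-adic limit is \<open>padic_Gamma\<close>, kept in the integers so
  that it can be studied with \<open>cong\<close> modulo every power of \<open>p\<close>.\<close>

definition morita_prod :: "nat \<Rightarrow> nat \<Rightarrow> int" where
  "morita_prod p m = (-1) ^ m * (\<Prod>k | 0 < k \<and> k < m \<and> coprime k p. int k)"

lemma morita_prod_0 [simp]: "morita_prod p 0 = 1"
  by (simp add: morita_prod_def)

text \<open>The integer form of the functional equation of the p-adic Gamma function; a multiple of
  \<open>p\<close> contributes only its sign.\<close>

lemma morita_prod_Suc:
  assumes "prime p"
  shows "morita_prod p (Suc m) = - (if p dvd m then 1 else int m) * morita_prod p m"
proof -
  have cop: "coprime m p \<longleftrightarrow> \<not> p dvd m" for m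
    using assms by (metis coprime_commute prime_imp_coprime coprime_absorb_right not_prime_unit)
  let ?A = "\<lambda>m. {k. 0 < k \<and> k < m \<and> coprime k p}"
  have fin: "finite (?A m)" for m by (rule finite_subset[of _ "{..<m}"]) auto
  show ?thesis
  proof (cases "p dvd m")
    case True
    then have "?A (Suc m) = ?A m" using cop by (auto simp: less_Suc_eq)
    then show ?thesis using True by (simp add: morita_prod_def)
  next
    case False
    then have "m > 0" by (cases m) auto
    then have "?A (Suc m) = insert m (?A m)" using cop False by (auto simp: less_Suc_eq)
    then show ?thesis using False fin by (simp add: morita_prod_def)
  qed
qed

text \<open>Since \<open>p dvd q\<close>, the case distinction in \<open>morita_prod_Suc\<close> is
  unchanged by adding \<open>q\<close>, so the recursion factors at \<open>m + q\<close> and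
  \<open>m\<close> agree modulo \<open>q\<close>.\<close>

lemma morita_prod_add_cong:
  assumes "prime p" "p dvd q"
  shows "[morita_prod p (m + q) = morita_prod p m * morita_prod p q] (mod int q)"
proof (induction m)
  case (Suc m)
  have iff: "p dvd m + q \<longleftrightarrow> p dvd m" using assms by (simp add: dvd_add_left_iff)
  let ?e = "\<lambda>k. - (if p dvd k then 1 else int k)"
  have "[?e (m + q) = ?e m] (mod int q)"
    by (auto simp: iff cong_iff_dvd_diff)
  from cong_mult[OF this Suc] show ?case
    using assms by (simp add: morita_prod_Suc mult.assoc)
qed simp

lemma morita_prod_add_mult_cong:
  assumes "prime p" "p dvd q"
  shows "[morita_prod p (m + j * q) = morita_prod p m * morita_prod p q ^ j] (mod int q)"
proof (induction j)
  case (Suc j)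
  have "[morita_prod p ((m + j * q) + q) = morita_prod p (m + j * q) * morita_prod p q] (mod int q)"
    by (rule morita_prod_add_cong[OF assms])
  also have "[morita_prod p (m + j * q) * morita_prod p q =
      (morita_prod p m * morita_prod p q ^ j) * morita_prod p q] (mod int q)"
    by (intro cong_mult Suc cong_refl)
  finally show ?case by (simp add: algebra_simps)
qed simp

lemma morita_prod_le:
  assumes "prime p" "0 < m" "m \<le> p"
  shows "morita_prod p m = (-1) ^ m * fact (m - 1)"
proof -
  have "{k. 0 < k \<and> k < m \<and> coprime k p} = {1..m - 1}"
    using assms by (auto simp: coprime_commute[of _ p] intro!: prime_imp_coprime dest: dvd_imp_le)
  then show ?thesis by (simp add: morita_prod_def fact_prod)
qed

text \<open>This is Wilson's theorem: for odd \<open>p\<close> the sign \<open>(-1) ^ p\<close>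
  cancels the sign of \<open>(p - 1)!\<close>.\<close>

lemma morita_prod_prime_cong_1:
  assumes "prime p" "odd p"
  shows "[morita_prod p p = 1] (mod int p)"
proof -
  have "[fact (p - 1) = - 1] (mod int p)" using assms(1) by (rule wilson_theorem)
  then have "[- fact (p - 1) = - (- 1)] (mod int p)" by (simp only: cong_minus_minus_iff)
  then show ?thesis using assms by (simp add: morita_prod_le prime_gt_0_nat)
qed

lemma morita_prod_cong_mod_prime:
  assumes "prime p" "odd p"
  shows "[morita_prod p (m + j * p) = morita_prod p m] (mod int p)"
proof -
  have "[morita_prod p m * morita_prod p p ^ j = morita_prod p m * 1 ^ j] (mod int p)"
    by (intro cong_mult cong_refl cong_pow morita_prod_prime_cong_1 assms)
  with morita_prod_add_mult_cong[OF assms(1) dvd_refl, of m j] show ?thesis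
    by (simp add: cong_trans)
qed

text \<open>Every further \<open>p\<close>-th power gains one factor \<open>p\<close>: in
  \<open>v ^ p - 1 = (v - 1) * (\<Sum>i<p. v ^ i)\<close> the sum has \<open>p\<close> terms, all
  congruent to 1 modulo \<open>p\<close>.\<close>

lemma power_prime_power_cong_1:
  fixes u :: int
  assumes "[u = 1] (mod int p)"
  shows "[u ^ (p ^ n) = 1] (mod int p ^ Suc n)"
proof (induction n)
  case (Suc n)
  define v where "v = u ^ (p ^ n)"
  have v: "[v = 1] (mod int p ^ Suc n)" using Suc by (simp add: v_def)
  have vp: "[v = 1] (mod int p)" using v by (rule cong_dvd_modulus) simp
  have "[(\<Sum>i<p. v ^ i) = (\<Sum>i<p. 1 ^ i)] (mod int p)"
    by (intro cong_sum cong_pow vp)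
  then have "int p dvd (\<Sum>i<p. v ^ i)" by (simp add: cong_dvd_iff)
  moreover have "int p ^ Suc n dvd v - 1" using v by (simp add: cong_iff_dvd_diff)
  ultimately have "int p ^ Suc n * int p dvd (v - 1) * (\<Sum>i<p. v ^ i)" by (rule mult_dvd_mono[rotated])
  also have "(v - 1) * (\<Sum>i<p. v ^ i) = v ^ p - 1" by (simp add: power_diff_1_eq)
  also have "v ^ p = u ^ (p ^ Suc n)" by (simp add: v_def power_mult [symmetric] mult.commute)
  finally show ?case by (simp add: cong_iff_dvd_diff mult.commute)
qed (use assms in simp)

text \<open>
  The modulus \<open>p ^ (2 * n + 1)\<close> is far from optimal; it suffices for the existence of the limit
  and avoids the generalisation of Wilson's theorem to prime powers.
\<close>

lemma morita_prod_continuous_aux: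
  assumes "prime p" "odd p"
  shows "[morita_prod p (m + j * p ^ (2 * n + 1)) = morita_prod p m] (mod int p ^ Suc n)"
proof -
  let ?q = "p ^ Suc n"
  \<comment> \<open>A shift by \<open>p ^ (2 * n + 1)\<close> consists of \<open>p ^ n\<close>
    shifts by \<open>p ^ Suc n\<close>. Each one multiplies by a number congruent to 1 modulo
    \<open>p\<close>, and the \<open>p ^ n\<close>-th power of that number is 1 modulo
    \<open>p ^ Suc n\<close>.\<close>
  have "[morita_prod p (0 + p ^ n * p) = morita_prod p 0] (mod int p)"
    by (rule morita_prod_cong_mod_prime[OF assms])
  then have "[morita_prod p ?q = 1] (mod int p)" by (simp add: mult.commute)
  then have *: "[morita_prod p ?q ^ (p ^ n) = 1] (mod int p ^ Suc n)" by (rule power_prime_power_cong_1)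
  have "[morita_prod p (m + (j * p ^ n) * ?q) = morita_prod p m * morita_prod p ?q ^ (j * p ^ n)]
      (mod int ?q)"
    by (rule morita_prod_add_mult_cong[OF assms(1)]) simp
  also have "morita_prod p ?q ^ (j * p ^ n) = (morita_prod p ?q ^ (p ^ n)) ^ j"
    by (simp add: power_mult [symmetric] mult.commute)
  also have "[morita_prod p m * (morita_prod p ?q ^ (p ^ n)) ^ j = morita_prod p m * 1 ^ j] (mod int ?q)"
    using * by (intro cong_mult cong_pow cong_refl) simp
  also have "(j * p ^ n) * ?q = j * p ^ (2 * n + 1)"
    by (simp add: power_add mult_2)
  finally show ?thesis by simp
qed

lemma morita_prod_continuous:
  assumes "prime p" "odd p" "[m = m'] (mod p ^ (2 * n))"
  shows "[morita_prod p m = morita_prod p m'] (mod int p ^ n)"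
proof (cases n)
  case 0
  then show ?thesis by simp
next
  case (Suc k)
  have *: "[morita_prod p m = morita_prod p m'] (mod int p ^ n)"
    if "[m = m'] (mod p ^ (2 * n))" "m' \<le> m" for m m'
  proof -
    have "[m = m'] (mod p ^ (2 * k + 1))"
      using that(1) by (rule cong_dvd_modulus_nat) (simp add: Suc)
    then have "p ^ (2 * k + 1) dvd m - m'" using that(2) by (simp add: cong_altdef_nat)
    then obtain j where "m - m' = p ^ (2 * k + 1) * j" by (rule dvdE)
    then have "m = m' + j * p ^ (2 * k + 1)" using that(2) by (simp add: mult.commute)
    then show ?thesis using morita_prod_continuous_aux[OF assms(1,2), of m' j k] Suc by simp
  qed
  show ?thesis
    using *[of m m'] *[of m' m] assms(3) by (metis cong_sym nat_le_linear)
qed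

lemma coprime_morita_prod:
  assumes "prime p"
  shows "coprime (morita_prod p m) (int p)"
proof (induction m)
  case (Suc m)
  have "\<not> p dvd m \<Longrightarrow> coprime (int m) (int p)"
    using assms by (metis coprime_commute coprime_int_iff prime_imp_coprime)
  then show ?case using Suc assms by (auto simp: morita_prod_Suc)
qed simp

section \<open>Morita's product modulo \<open>p ^ 2\<close> along progressions of step
  \<open>p\<close>\<close>

lemma fact_shift_by_prime_cong:
  assumes "prime p" "odd p"
  shows "[(\<Prod>k=1..p - 1. int (p + k)) = fact (p - 1)] (mod int p ^ 2)"
proof -
  define X Y :: int where "X = (\<Prod>k=1..p - 1. int (p + k))" and "Y = (\<Prod>k=1..p - 1. int k)"
  have Y: "Y = fact (p - 1)" by (simp add: Y_def fact_prod)
  have sq: "(\<Prod>k=1..p - 1. f k)\<^sup>2 = (\<Prod>k=1..p - 1. f k * f (p - k))" for f :: "nat \<Rightarrow> int"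
  proof -
    have "(\<Prod>k=1..p - 1. f (p - k)) = (\<Prod>k=1..p - 1. f k)"
      by (rule prod.reindex_bij_witness[of _ "\<lambda>k. p - k" "\<lambda>k. p - k"]) auto
    then show ?thesis by (simp add: prod.distrib power2_eq_square)
  qed
  \<comment> \<open>Pairing \<open>k\<close> with \<open>p - k\<close> removes the term linear in
    \<open>p\<close>: \<open>(p + k) * (2 * p - k) = k * (p - k) + 2 * p ^ 2\<close>.\<close>
  have "[X\<^sup>2 = Y\<^sup>2] (mod int p ^ 2)"
    unfolding X_def Y_def sq
  proof (rule cong_prod)
    fix k assume "k \<in> {1..p - 1}"
    then have "int (p - k) = int p - int k" by auto
    then have "int (p + k) * int (p + (p - k)) - int k * int (p - k) = int p ^ 2 * 2"
      by (simp add: algebra_simps power2_eq_square)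
    then show "[int (p + k) * int (p + (p - k)) = int k * int (p - k)] (mod int p ^ 2)"
      by (simp add: cong_iff_dvd_diff)
  qed
  then have dvd: "int p ^ 2 dvd (X + Y) * (X - Y)"
    by (simp add: cong_iff_dvd_diff power2_eq_square algebra_simps)
  \<comment> \<open>The sign of the square root is fixed modulo \<open>p\<close>:
    \<open>X + Y\<close> is congruent to the unit \<open>2 * Y\<close>, so \<open>p ^ 2\<close> must
    divide \<open>X - Y\<close>.\<close>
  have "[X = Y] (mod int p)" unfolding X_def Y_def
    by (rule cong_prod) (simp add: cong_iff_dvd_diff)
  then have "[X + Y = 2 * Y] (mod int p)" by (simp add: cong_iff_dvd_diff)
  moreover have "coprime (2 * Y) (int p)"
  proof -
    have "coprime (int p) Y" unfolding Y_def
    proof (rule prod_coprime_right)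
      fix k assume "k \<in> {1..p - 1}"
      then have "\<not> p dvd k" by (auto dest: dvd_imp_le)
      then show "coprime (int p) (int k)" using assms(1) by (simp add: prime_imp_coprime)
    qed
    moreover have "coprime (int p) 2" using assms(2) by simp
    ultimately show ?thesis by (simp add: coprime_commute)
  qed
  ultimately have "coprime (X + Y) (int p)" by (metis cong_imp_coprime cong_sym)
  then have "coprime (int p ^ 2) (X + Y)" by (simp add: coprime_commute)
  with dvd have "int p ^ 2 dvd X - Y" by (simp add: coprime_dvd_mult_right_iff)
  then show ?thesis using Y by (simp add: cong_iff_dvd_diff X_def)
qed

text \<open>Beyond \<open>p\<close> the factors are those of \<open>(p - 1)!\<close> shifted by
  \<open>p\<close>, which leaves their product unchanged modulo \<open>p ^ 2\<close>. This is the
  case \<open>m = 0\<close> of \<open>morita_prod_log_affine\<close>.\<close>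

lemma morita_prod_twice_prime:
  assumes "prime p" "odd p"
  shows "[morita_prod p (2 * p) = morita_prod p p ^ 2] (mod int p ^ 2)"
proof -
  have p0: "p > 0" using assms by (simp add: prime_gt_0_nat)
  have step: "morita_prod p (p + Suc j) = - morita_prod p p * (-1) ^ j * (\<Prod>k=1..j. int (p + k))"
    if "j < p" for j
    using that
  proof (induction j)
    case 0
    then show ?case using assms by (simp add: morita_prod_Suc)
  next
    case (Suc j)
    have "\<not> p dvd p + Suc j" unfolding dvd_add_triv_left_iff using Suc.prems by (auto dest: dvd_imp_le)
    then show ?case using Suc morita_prod_Suc[OF assms(1), of "p + Suc j"] by (simp add: algebra_simps)
  qed
  have "2 * p = p + Suc (p - 1)" using p0 by simp
  then have *: "morita_prod p (2 * p) = - morita_prod p p * (-1) ^ (p - 1) * (\<Prod>k=1..p - 1. int (p + k))"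
    using step[of "p - 1"] p0 by (simp add: mult_2)
  have e: "even (p - 1)" using assms p0 by simp
  have fp: "morita_prod p p = - fact (p - 1)" using assms p0 by (simp add: morita_prod_le)
  have "morita_prod p (2 * p) = - morita_prod p p * (\<Prod>k=1..p - 1. int (p + k))"
    using * e by simp
  also have "[\<dots> = - morita_prod p p * fact (p - 1)] (mod int p ^ 2)"
    by (intro cong_mult cong_refl fact_shift_by_prime_cong assms)
  also have "- morita_prod p p * fact (p - 1) = morita_prod p p ^ 2"
    by (simp add: fp power2_eq_square)
  finally show ?thesis .
qed

text \<open>Three values at distance \<open>p\<close> are in geometric progression. The induction
  step rests on \<open>(m + 2 * p) * m = (m + p) ^ 2 - p ^ 2\<close> for the recursion
  factors.\<close>

lemma morita_prod_log_affine:
  assumes "prime p" "odd p"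
  shows "[morita_prod p (m + 2 * p) * morita_prod p m = morita_prod p (m + p) ^ 2] (mod int p ^ 2)"
proof (induction m)
  case 0
  then show ?case using morita_prod_twice_prime[OF assms] by simp
next
  case (Suc m)
  have d1: "p dvd m + p \<longleftrightarrow> p dvd m" and d2: "p dvd m + 2 * p \<longleftrightarrow> p dvd m"
    by (simp_all add: dvd_add_left_iff)
  let ?e = "\<lambda>k. - (if p dvd k then 1 else int k)"
  have "[?e (m + 2 * p) * ?e m = ?e (m + p) ^ 2] (mod int p ^ 2)"
    unfolding d1 d2 by (simp add: cong_iff_dvd_diff power2_eq_square algebra_simps)
  from cong_mult[OF this Suc]
  have "[(?e (m + 2 * p) * morita_prod p (m + 2 * p)) * (?e m * morita_prod p m) =
      (?e (m + p) * morita_prod p (m + p)) ^ 2] (mod int p ^ 2)"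
    by (simp only: power_mult_distrib mult_ac)
  then show ?case using morita_prod_Suc[OF assms(1)] by simp
qed

text \<open>Modulo \<open>p ^ 2\<close>, a geometric progression with ratio congruent to 1 modulo
  \<open>p\<close> is also arithmetic, because a product of two of its differences vanishes.\<close>

lemma morita_prod_affine:
  assumes "prime p" "odd p"
  shows "[morita_prod p (m + j * p) =
      morita_prod p m + int j * (morita_prod p (m + p) - morita_prod p m)] (mod int p ^ 2)"
proof -
  \<comment> \<open>For consecutive terms \<open>x\<close>, \<open>y\<close>, \<open>z\<close> both
    summands on the left of \<open>id\<close> vanish modulo \<open>p ^ 2\<close>; cancelling the
    unit \<open>y\<close> then equates the two differences.\<close>
  let ?s = "\<lambda>j. morita_prod p (m + j * p)"
  have id: "z * x - y ^ 2 + (y - x) * (z - y) = y * ((z - y) - (y - x))" for x y z :: int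
    by (simp add: algebra_simps power2_eq_square)
  have diff: "[?s (Suc j) - ?s j = ?s 1 - ?s 0] (mod int p ^ 2)" for j
  proof (induction j)
    case (Suc j)
    define d e where "d = ?s (Suc j) - ?s j" and "e = ?s (Suc (Suc j)) - ?s (Suc j)"
    have per: "int p dvd ?s i - ?s 0" for i
      using morita_prod_cong_mod_prime[OF assms, of m i] by (simp add: cong_iff_dvd_diff)
    have "int p dvd d" "int p dvd e"
      unfolding d_def e_def using per[of j] per[of "Suc j"] per[of "Suc (Suc j)"]
      by (metis (no_types, lifting) cong_iff_dvd_diff cong_sym cong_trans)+
    then have "int p ^ 2 dvd d * e" unfolding power2_eq_square by (rule mult_dvd_mono)
    moreover have "int p ^ 2 dvd ?s (Suc (Suc j)) * ?s j - ?s (Suc j) ^ 2"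
      using morita_prod_log_affine[OF assms, of "m + j * p"]
      by (simp add: cong_iff_dvd_diff mult_2 add_ac)
    ultimately have "int p ^ 2 dvd (?s (Suc (Suc j)) * ?s j - ?s (Suc j) ^ 2) + d * e"
      by (rule dvd_add[rotated])
    also have "(?s (Suc (Suc j)) * ?s j - ?s (Suc j) ^ 2) + d * e = ?s (Suc j) * (e - d)"
      unfolding d_def e_def by (rule id)
    finally have "int p ^ 2 dvd e - d"
      using coprime_morita_prod[OF assms(1), of "m + Suc j * p"]
      by (subst (asm) coprime_dvd_mult_right_iff) (simp_all add: coprime_commute)
    then have "[e = d] (mod int p ^ 2)" by (simp add: cong_iff_dvd_diff)
    with Suc show ?case unfolding d_def e_def by (rule cong_trans[rotated])
  qed simp
  show ?thesis
  proof (induction j)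
    case (Suc j)
    from cong_add[OF Suc diff[of j]] show ?case by (simp add: algebra_simps)
  qed simp
qed

section \<open>The ring of p-adic integers and the p-adic Gamma function\<close>

lemma padic_mod_mod [simp]:
  "padic_mod (x :: 'p :: prime_card padic_int) n mod int CARD('p) ^ n = padic_mod x n"
  using padic_mod[of x] by (auto intro: mod_pos_pos_trivial)

lemma padic_mod_nonneg [simp]: "0 \<le> padic_mod x n"
  using padic_mod[of x] by auto

lemma padic_mod_of_int:
  "padic_mod (of_int i :: 'p :: prime_card padic_int) n = i mod int CARD('p) ^ n"
proof (cases i rule: int_cases2)
  case (nonpos k)
  then show ?thesis
    by (simp only: of_int_minus of_int_of_nat_eq padic_mod_of_nat uminus_padic_int.rep_eq mod_minus_eq)
qed (simp only: of_int_of_nat_eq padic_mod_of_nat)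

lemma padic_mod_of_nat_residue:
  "padic_mod (of_nat (nat (padic_mod x n)) :: 'p padic_int) n = padic_mod (x :: 'p :: prime_card padic_int) n"
  by (simp add: padic_mod_of_int)

lemma padic_mod_mod_le:
  fixes x :: "'p :: prime_card padic_int"
  assumes "m \<le> n"
  shows "padic_mod x n mod int CARD('p) ^ m = padic_mod x m"
  using padic_mod_eq_mono[OF padic_mod_of_nat_residue[of x n] assms] by (simp add: padic_mod_of_int)

lemma padic_int_eqI:
  "(\<And>n. padic_mod x n = padic_mod y n) \<Longrightarrow> x = (y :: 'p :: prime_card padic_int)"
  by (simp add: padic_mod_inject[symmetric] fun_eq_iff)

text \<open>Builds an element of the inverse limit from coherent integers that need not be reduced
  residues.\<close>

lemma ex_padic_int:
  assumes "\<And>n. f (Suc n) mod int CARD('p :: prime_card) ^ n = f n mod int CARD('p) ^ n"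
  obtains x :: "'p :: prime_card padic_int" where "\<And>n. padic_mod x n = f n mod int CARD('p) ^ n"
proof
  fix n
  show "padic_mod (Abs_padic_int (\<lambda>n. f n mod int CARD('p) ^ n) :: 'p padic_int) n =
      f n mod int CARD('p) ^ n"
    using padic_coherent[of f, OF assms] by (subst Abs_padic_int_inverse) blast+
qed

lemma prime_power_dvd_padic_iff:
  "of_nat CARD('p) ^ n dvd x \<longleftrightarrow> padic_mod (x :: 'p :: prime_card padic_int) n = 0"
proof
  assume "of_nat CARD('p) ^ n dvd x"
  then obtain y where "x = of_nat (CARD('p) ^ n) * y" by auto
  moreover have "padic_mod (of_nat (CARD('p) ^ n) :: 'p padic_int) n = 0"
    unfolding padic_mod_of_nat by simp
  ultimately show "padic_mod x n = 0" by (simp add: times_padic_int.rep_eq)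
next
  assume x: "padic_mod x n = 0"
  let ?p = "int CARD('p)"
  \<comment> \<open>The residues of the quotient; the index is shifted by \<open>n\<close> because
    dividing by \<open>p ^ n\<close> loses \<open>n\<close> digits of precision.\<close>
  define f where "f m = padic_mod x (m + n) div ?p ^ n" for m
  have f: "padic_mod x (m + n) = ?p ^ n * f m" for m
    using padic_mod_mod_le[of n "m + n" x] x by (auto simp: f_def)
  have "f (Suc m) mod ?p ^ m = f m mod ?p ^ m" for m
  proof -
    have "?p ^ n * (f (Suc m) mod ?p ^ m) = padic_mod x (Suc m + n) mod ?p ^ (m + n)"
      unfolding f power_add mult.commute[of "?p ^ m"] by (rule mult_mod_right)
    also have "\<dots> = padic_mod x (m + n) mod ?p ^ (m + n)"
      by (subst padic_mod_mod_le) simp_all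
    also have "\<dots> = ?p ^ n * (f m mod ?p ^ m)"
      unfolding f power_add mult.commute[of "?p ^ m"] by (rule mult_mod_right[symmetric])
    finally show ?thesis using card_prime_pos[where 'p = 'p] by simp
  qed
  then obtain y :: "'p padic_int" where y: "\<And>m. padic_mod y m = f m mod ?p ^ m"
    using ex_padic_int[of f, where 'p = 'p] by blast
  have "x = of_nat (CARD('p) ^ n) * y"
  proof (rule padic_int_eqI)
    fix m
    have "padic_mod (of_nat (CARD('p) ^ n) * y) m = padic_mod x (m + n) mod ?p ^ m"
      unfolding f times_padic_int.rep_eq padic_mod_of_nat y by (simp add: mod_mult_eq)
    then show "padic_mod x m = padic_mod (of_nat (CARD('p) ^ n) * y) m"
      by (simp add: padic_mod_mod_le)
  qed
  then show "of_nat CARD('p) ^ n dvd x" by simp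
qed

lemma prime_power_dvd_padic_diff_iff:
  "of_nat CARD('p) ^ n dvd x - y \<longleftrightarrow>
     padic_mod (x :: 'p :: prime_card padic_int) n = padic_mod y n"
  by (simp add: prime_power_dvd_padic_iff padic_mod_diff_eq_0_iff)

lemma ex_nat_near_padic:
  "\<exists>m. of_nat CARD('p) ^ n dvd (x :: 'p :: prime_card padic_int) - of_nat m"
  unfolding prime_power_dvd_padic_diff_iff using padic_mod_of_nat_residue[of x n] by metis

text \<open>Inverses of \<open>k\<close> exist modulo every \<open>p ^ n\<close>, and their
  uniqueness makes them coherent.\<close>

lemma of_nat_padic_unit:
  assumes "coprime k CARD('p)"
  shows "(of_nat k :: 'p :: prime_card padic_int) dvd 1"
proof -
  let ?p = "int CARD('p)"
  have "\<exists>y. [int k * y = 1] (mod ?p ^ n)" for n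
    using assms by (intro cong_solve_coprime_int) (simp flip: of_nat_power)
  then obtain f where f: "\<And>n. [int k * f n = 1] (mod ?p ^ n)" by metis
  have "f (Suc n) mod ?p ^ n = f n mod ?p ^ n" for n
  proof -
    have "[int k * f (Suc n) = 1] (mod ?p ^ n)"
      using f[of "Suc n"] by (rule cong_dvd_modulus) simp
    then have "[int k * f (Suc n) = int k * f n] (mod ?p ^ n)"
      using f[of n] by (metis cong_sym cong_trans)
    then have "[f (Suc n) = f n] (mod ?p ^ n)"
      using assms by (subst (asm) cong_mult_lcancel) (simp_all flip: of_nat_power)
    then show ?thesis by (simp add: cong_def)
  qed
  then obtain y :: "'p padic_int" where y: "\<And>m. padic_mod y m = f m mod ?p ^ m"
    using ex_padic_int[of f, where 'p = 'p] by blast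
  have "of_nat k * y = 1"
    by (rule padic_int_eqI)
      (use f in \<open>simp add: times_padic_int.rep_eq one_padic_int.rep_eq padic_mod_of_nat y
        mod_simps cong_def\<close>)
  then show ?thesis by (metis dvd_triv_left)
qed

section \<open>Residue-wise convergence and existence of the limit defining
  \<open>padic_Gamma\<close>\<close>

lemma padic_tendsto_iff:
  fixes f :: "'b \<Rightarrow> 'p :: prime_card padic_int"
  shows "(f \<longlongrightarrow> l) F \<longleftrightarrow> (\<forall>n. \<forall>\<^sub>F y in F. padic_mod (f y) n = padic_mod l n)"
proof -
  let ?p = "real CARD('p)"
  have p1: "1 < ?p" using prime_gt_1_nat[OF prime_card[where 'a = 'p]] by simp
  \<comment> \<open>The balls of radius \<open>1 / p ^ n\<close> are exactly the residue classes
    modulo \<open>p ^ n\<close>, so convergence means that every residue is eventually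
    constant.\<close>
  have le: "dist x y \<le> 1 / ?p ^ n \<longleftrightarrow> padic_mod x n = padic_mod y n" for x y :: "'p padic_int" and n
    by (simp add: dist_padic_int_def padic_abs_le_iff padic_mod_diff_eq_0_iff)
  show ?thesis
  proof
    assume lim: "(f \<longlongrightarrow> l) F"
    show "\<forall>n. \<forall>\<^sub>F y in F. padic_mod (f y) n = padic_mod l n"
    proof
      fix n
      have "1 / ?p ^ n > 0" using p1 by simp
      from tendstoD[OF lim this] show "\<forall>\<^sub>F y in F. padic_mod (f y) n = padic_mod l n"
        by eventually_elim (use le in force)
    qed
  next
    assume ev: "\<forall>n. \<forall>\<^sub>F y in F. padic_mod (f y) n = padic_mod l n"
    show "(f \<longlongrightarrow> l) F"
    proof (rule tendstoI)
      fix e :: real assume "e > 0"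
      then obtain n where n: "(1 / ?p) ^ n < e" using p1 real_arch_pow_inv[of e "1 / ?p"] by auto
      have "\<forall>\<^sub>F y in F. padic_mod (f y) n = padic_mod l n" using ev by blast
      then show "\<forall>\<^sub>F y in F. dist (f y) l < e"
        by eventually_elim (use le n in \<open>force simp: power_one_over\<close>)
    qed
  qed
qed

text \<open>Any natural number agreeing with \<open>x\<close> modulo \<open>p ^ (2 * n)\<close>
  determines the value modulo \<open>p ^ n\<close>. The proof assembles the limit \<open>L\<close>
  from the residues of \<open>morita_prod\<close> at the approximations \<open>N n\<close>.\<close>

lemma padic_mod_padic_Gamma:
  fixes x :: "'p :: prime_card padic_int"
  assumes odd: "odd CARD('p)" and near: "padic_mod (of_nat m :: 'p padic_int) (2 * n) = padic_mod x (2 * n)"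
  shows "padic_mod (padic_Gamma x) n = padic_mod (of_int (morita_prod CARD('p) m) :: 'p padic_int) n"
proof -
  let ?p = "int CARD('p)" and ?G = "morita_prod CARD('p)"
  define N where "N n = nat (padic_mod x (2 * n))" for n
  have cont: "?G m mod ?p ^ n = ?G m' mod ?p ^ n"
    if "padic_mod (of_nat m :: 'p padic_int) (2 * n) = padic_mod (of_nat m' :: 'p padic_int) (2 * n)"
    for m m' n
  proof -
    have "int (m mod CARD('p) ^ (2 * n)) = int (m' mod CARD('p) ^ (2 * n))"
      using that by (simp add: padic_mod_of_nat zmod_int)
    then show ?thesis
      using morita_prod_continuous[OF prime_card odd, of m m' n] by (simp add: cong_def)
  qed
  have N: "padic_mod (of_nat (N n) :: 'p padic_int) (2 * n) = padic_mod x (2 * n)" for n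
    unfolding N_def by (rule padic_mod_of_nat_residue)
  have "?G (N (Suc n)) mod ?p ^ n = ?G (N n) mod ?p ^ n" for n
  proof (rule cont)
    have "padic_mod (of_nat (N (Suc n)) :: 'p padic_int) (2 * n) = padic_mod x (2 * n)"
      using N[of "Suc n"] by (rule padic_mod_eq_mono) simp
    then show "padic_mod (of_nat (N (Suc n)) :: 'p padic_int) (2 * n) =
        padic_mod (of_nat (N n) :: 'p padic_int) (2 * n)"
      using N by simp
  qed
  then obtain L :: "'p padic_int" where L: "\<And>n. padic_mod L n = ?G (N n) mod ?p ^ n"
    using ex_padic_int[of "\<lambda>n. ?G (N n)", where 'p = 'p] by blast
  let ?F = "filtercomap of_nat (nhds x)"
  have ev: "\<forall>\<^sub>F m in ?F. padic_mod (of_nat m :: 'p padic_int) k = padic_mod x k" for k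
    using filterlim_filtercomap[of of_nat "nhds x"] unfolding padic_tendsto_iff by blast
  \<comment> \<open>\<open>Lim\<close> picks out \<open>L\<close> only if limits along
    \<open>?F\<close> are unique; this is the density of the natural numbers in the p-adic
    integers.\<close>
  have nontriv: "?F \<noteq> bot"
  proof (rule filtercomap_neq_bot)
    fix P assume "eventually P (nhds x)"
    then obtain e where e: "e > 0" "\<And>y. dist y x < e \<Longrightarrow> P y" unfolding eventually_nhds_metric by auto
    have "(\<lambda>n. of_nat (nat (padic_mod x n))) \<longlonglongrightarrow> x"
      unfolding padic_tendsto_iff
    proof
      fix n
      have "padic_mod (of_nat (nat (padic_mod x k)) :: 'p padic_int) n = padic_mod x n" if "n \<le> k" for k
        using padic_mod_of_nat_residue[of x k] that by (rule padic_mod_eq_mono)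
      then show "\<forall>\<^sub>F k in sequentially.
          padic_mod (of_nat (nat (padic_mod x k)) :: 'p padic_int) n = padic_mod x n"
        unfolding eventually_sequentially by blast
    qed
    from tendstoD[OF this e(1)] show "\<exists>m. P (of_nat m)"
      using e(2) unfolding eventually_sequentially by blast
  qed
  have "((\<lambda>m. (-1) ^ m * (\<Prod>k | 0 < k \<and> k < m \<and> coprime k CARD('p). of_nat k)) \<longlongrightarrow> L) ?F"
    unfolding padic_tendsto_iff
  proof
    fix n
    show "\<forall>\<^sub>F m in ?F. padic_mod ((-1) ^ m * (\<Prod>k | 0 < k \<and> k < m \<and> coprime k CARD('p). of_nat k)
        :: 'p padic_int) n =
        padic_mod L n"
      using ev[of "2 * n"]
    proof eventually_elim
      case (elim m)
      have "?G m mod ?p ^ n = ?G (N n) mod ?p ^ n" by (rule cont) (simp add: elim N)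
      moreover have "(-1) ^ m * (\<Prod>k | 0 < k \<and> k < m \<and> coprime k CARD('p). of_nat k) =
          (of_int (?G m) :: 'p padic_int)" by (simp add: morita_prod_def)
      ultimately show ?case by (simp only: padic_mod_of_int L)
    qed
  qed
  then have "padic_Gamma x = L" unfolding padic_Gamma_def by (rule tendsto_Lim[OF nontriv])
  moreover have "?G (N n) mod ?p ^ n = ?G m mod ?p ^ n" by (rule cont) (simp add: near N)
  ultimately show ?thesis by (simp only: padic_mod_of_int L)
qed

section \<open>Congruences and affine functions modulo the square of p\<close>

definition sq_cong :: "'p :: prime_card padic_int \<Rightarrow> 'p padic_int \<Rightarrow> bool" (infix "\<approx>" 50) where
  "x \<approx> y \<longleftrightarrow> of_nat CARD('p) ^ 2 dvd x - y"

lemma sq_cong_iff: "x \<approx> y \<longleftrightarrow> padic_mod x 2 = padic_mod y 2"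
  by (simp add: sq_cong_def prime_power_dvd_padic_diff_iff)

lemma sq_cong_refl [simp, intro]: "x \<approx> x"
  and sq_cong_sym: "x \<approx> y \<Longrightarrow> y \<approx> x"
  and sq_cong_trans [trans]: "x \<approx> y \<Longrightarrow> y \<approx> z \<Longrightarrow> x \<approx> z"
  by (simp_all add: sq_cong_iff)

lemma sq_cong_add: "x \<approx> y \<Longrightarrow> x' \<approx> y' \<Longrightarrow> x + x' \<approx> y + y'"
  and sq_cong_diff: "x \<approx> y \<Longrightarrow> x' \<approx> y' \<Longrightarrow> x - x' \<approx> y - y'"
  and sq_cong_mult: "x \<approx> y \<Longrightarrow> x' \<approx> y' \<Longrightarrow> x * x' \<approx> y * y'"
  and sq_cong_minus: "x \<approx> y \<Longrightarrow> - x \<approx> - y"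
  by (simp_all add: sq_cong_iff plus_padic_int.rep_eq minus_padic_int.rep_eq
      times_padic_int.rep_eq uminus_padic_int.rep_eq)

lemma sq_cong_power: "x \<approx> y \<Longrightarrow> x ^ n \<approx> y ^ n"
  by (induction n) (simp_all add: sq_cong_mult)

lemma sq_cong_cancel:
  fixes u :: "'p :: prime_card padic_int"
  assumes "u dvd 1" "u * x \<approx> u * y"
  shows "x \<approx> y"
proof -
  have "inverse u * (u * x) \<approx> inverse u * (u * y)" by (intro sq_cong_mult sq_cong_refl assms)
  moreover have "inverse u * (u * z) = z" for z
    using padic_mult_inverse[OF assms(1)] by (metis mult.assoc mult.commute mult_1)
  ultimately show ?thesis by simp
qed

lemma sq_cong_of_int:
  "(of_int i :: 'p :: prime_card padic_int) \<approx> of_int j \<longleftrightarrow> [i = j] (mod int CARD('p) ^ 2)"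
  by (simp add: sq_cong_iff padic_mod_of_int cong_def)

text \<open>The general continuity bound would demand agreement modulo \<open>p ^ 4\<close>;
  affineness of \<open>morita_prod\<close> lowers this to \<open>p ^ 2\<close>.\<close>

lemma padic_Gamma_sq_cong:
  fixes x :: "'p :: prime_card padic_int"
  assumes odd: "odd CARD('p)" and x: "x \<approx> of_nat m"
  shows "padic_Gamma x \<approx> of_int (morita_prod CARD('p) m)"
proof -
  let ?p = "CARD('p)" and ?G = "morita_prod CARD('p)"
  have prime: "prime ?p" by (rule prime_card)
  \<comment> \<open>A shift by \<open>j * p ^ 2\<close> is \<open>j * p\<close> steps of size
    \<open>p\<close>, and the common increment of a step modulo \<open>p ^ 2\<close> is itself
    divisible by \<open>p\<close>.\<close>
  have close: "[?G (i + j * ?p\<^sup>2) = ?G i] (mod int ?p ^ 2)" for i j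
  proof -
    have "int ?p dvd ?G (i + 1 * ?p) - ?G i"
      using morita_prod_cong_mod_prime[OF prime odd, of i 1] by (simp only: cong_iff_dvd_diff)
    then have "int ?p ^ 2 dvd int (j * ?p) * (?G (i + ?p) - ?G i)"
      by (simp add: power2_eq_square mult_dvd_mono)
    then have "[?G i + int (j * ?p) * (?G (i + ?p) - ?G i) = ?G i + 0] (mod int ?p ^ 2)"
      by (intro cong_add cong_refl) (simp only: cong_0_iff)
    with morita_prod_affine[OF prime odd, of i "j * ?p"]
    have "[?G (i + j * ?p * ?p) = ?G i + 0] (mod int ?p ^ 2)" by (rule cong_trans)
    then show ?thesis by (simp add: power2_eq_square mult.assoc)
  qed
  obtain N where N: "of_nat ?p ^ 4 dvd x - of_nat N" using ex_nat_near_padic[of 4 x] by blast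
  then have N4: "padic_mod (of_nat N :: 'p padic_int) (2 * 2) = padic_mod x (2 * 2)"
    by (simp add: prime_power_dvd_padic_diff_iff)
  have N2: "padic_mod (of_nat N :: 'p padic_int) 2 = padic_mod x 2"
    using N4 by (rule padic_mod_eq_mono) simp
  then have Nm: "[N = m] (mod ?p\<^sup>2)"
  proof -
    have "int (N mod ?p\<^sup>2) = int (m mod ?p\<^sup>2)"
      using x N2
      by (simp add: sq_cong_iff padic_mod_of_nat zmod_int)
    then show ?thesis by (simp add: cong_def)
  qed
  have "[?G N = ?G m] (mod int ?p ^ 2)"
  proof (cases "m \<le> N")
    case True
    then obtain j where "N = m + j * ?p\<^sup>2" using Nm
      by (metis cong_altdef_nat dvd_def le_add_diff_inverse mult.commute)
    then show ?thesis using close by simp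
  next
    case False
    then obtain j where "m = N + j * ?p\<^sup>2" using Nm
      by (metis cong_altdef_nat cong_sym dvd_def le_add_diff_inverse mult.commute nat_le_linear)
    then show ?thesis using close cong_sym by metis
  qed
  then have "of_int (?G N) \<approx> (of_int (?G m) :: 'p padic_int)" by (simp add: sq_cong_of_int)
  moreover have "padic_Gamma x \<approx> of_int (?G N)"
    unfolding sq_cong_iff by (rule padic_mod_padic_Gamma[OF odd N4])
  ultimately show ?thesis by (rule sq_cong_trans[rotated])
qed

text \<open>The slope \<open>B\<close> may vary with the base point \<open>x\<close> but not with
  \<open>t\<close>, so two values of \<open>t\<close> whose difference is a unit determine
  \<open>f\<close> modulo \<open>p ^ 2\<close> on the class of \<open>x\<close>.\<close>

definition affine_mod_sq :: "('p :: prime_card padic_int \<Rightarrow> 'p padic_int) \<Rightarrow> bool" where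
  "affine_mod_sq f \<longleftrightarrow>
     (\<forall>x. \<exists>B. \<forall>t. f (x + of_nat CARD('p) * t) \<approx> f x + of_nat CARD('p) * t * B)"

section \<open>Closure properties of affine functions modulo \<open>p ^ 2\<close>\<close>

lemma affine_mod_sq_const: "affine_mod_sq (\<lambda>_. c)"
  unfolding affine_mod_sq_def by (intro allI exI[of _ 0]) simp

lemma affine_mod_sq_id: "affine_mod_sq (\<lambda>x. x)"
  unfolding affine_mod_sq_def by (intro allI exI[of _ 1]) simp

lemma affine_mod_sq_add:
  fixes f g :: "'p :: prime_card padic_int \<Rightarrow> 'p padic_int"
  assumes "affine_mod_sq f" "affine_mod_sq g"
  shows "affine_mod_sq (\<lambda>x. f x + g x)"
  unfolding affine_mod_sq_def
proof
  fix x
  let ?p = "of_nat CARD('p) :: 'p padic_int"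
  obtain B C where B: "\<And>t. f (x + ?p * t) \<approx> f x + ?p * t * B"
    and C: "\<And>t. g (x + ?p * t) \<approx> g x + ?p * t * C"
    using assms unfolding affine_mod_sq_def by metis
  have "f (x + ?p * t) + g (x + ?p * t) \<approx> f x + g x + ?p * t * (B + C)" for t
    using sq_cong_add[OF B[of t] C[of t]] by (simp add: algebra_simps)
  then show "\<exists>B. \<forall>t. f (x + ?p * t) + g (x + ?p * t) \<approx> f x + g x + ?p * t * B" by blast
qed

lemma affine_mod_sq_mult:
  fixes f g :: "'p :: prime_card padic_int \<Rightarrow> 'p padic_int"
  assumes "affine_mod_sq f" "affine_mod_sq g"
  shows "affine_mod_sq (\<lambda>x. f x * g x)"
  unfolding affine_mod_sq_def
proof
  fix x
  let ?p = "of_nat CARD('p) :: 'p padic_int"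
  obtain B C where B: "\<And>t. f (x + ?p * t) \<approx> f x + ?p * t * B"
    and C: "\<And>t. g (x + ?p * t) \<approx> g x + ?p * t * C"
    using assms unfolding affine_mod_sq_def by metis
  have "f (x + ?p * t) * g (x + ?p * t) \<approx> f x * g x + ?p * t * (B * g x + f x * C)" for t
  proof -
    have "(f x + ?p * t * B) * (g x + ?p * t * C) - (f x * g x + ?p * t * (B * g x + f x * C)) =
        ?p ^ 2 * (t * t * B * C)" by (simp add: algebra_simps power2_eq_square)
    then have "(f x + ?p * t * B) * (g x + ?p * t * C) \<approx> f x * g x + ?p * t * (B * g x + f x * C)"
      unfolding sq_cong_def by simp
    with sq_cong_mult[OF B[of t] C[of t]] show ?thesis by (rule sq_cong_trans)
  qed
  then show "\<exists>B. \<forall>t. f (x + ?p * t) * g (x + ?p * t) \<approx> f x * g x + ?p * t * B" by blast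
qed

lemma affine_mod_sq_uminus: "affine_mod_sq f \<Longrightarrow> affine_mod_sq (\<lambda>x. - f x)"
  using affine_mod_sq_mult[OF affine_mod_sq_const[of "-1"], of f] by simp

lemma affine_mod_sq_diff:
  "affine_mod_sq f \<Longrightarrow> affine_mod_sq g \<Longrightarrow> affine_mod_sq (\<lambda>x. f x - g x)"
  using affine_mod_sq_add[OF _ affine_mod_sq_uminus, of f g] by simp

lemma affine_mod_sq_power: "affine_mod_sq f \<Longrightarrow> affine_mod_sq (\<lambda>x. f x ^ n)"
  by (induction n) (simp_all add: affine_mod_sq_const affine_mod_sq_mult)

lemma affine_mod_sq_sum:
  "(\<And>i. i \<in> A \<Longrightarrow> affine_mod_sq (f i)) \<Longrightarrow> affine_mod_sq (\<lambda>x. \<Sum>i\<in>A. f i x)"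
  by (induction A rule: infinite_finite_induct) (simp_all add: affine_mod_sq_const affine_mod_sq_add)

lemma affine_mod_sq_pochhammer: "affine_mod_sq f \<Longrightarrow> affine_mod_sq (\<lambda>x. pochhammer (f x) k)"
  by (induction k)
    (simp_all add: pochhammer_Suc affine_mod_sq_const affine_mod_sq_mult affine_mod_sq_add)

lemma affine_mod_sq_compose_linear:
  fixes f :: "'p :: prime_card padic_int \<Rightarrow> 'p padic_int"
  assumes "affine_mod_sq f"
  shows "affine_mod_sq (\<lambda>x. f (c * x + d))"
  unfolding affine_mod_sq_def
proof
  fix x
  let ?p = "of_nat CARD('p) :: 'p padic_int"
  obtain B where B: "\<And>t. f ((c * x + d) + ?p * t) \<approx> f (c * x + d) + ?p * t * B"
    using assms unfolding affine_mod_sq_def by metis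
  have "f (c * (x + ?p * t) + d) \<approx> f (c * x + d) + ?p * t * (c * B)" for t
    using B[of "c * t"] by (simp add: algebra_simps)
  then show "\<exists>B. \<forall>t. f (c * (x + ?p * t) + d) \<approx> f (c * x + d) + ?p * t * B" by blast
qed

lemma affine_mod_sq_padic_Gamma:
  assumes odd: "odd CARD('p)"
  shows "affine_mod_sq (padic_Gamma :: 'p :: prime_card padic_int \<Rightarrow> 'p padic_int)"
  unfolding affine_mod_sq_def
proof
  fix x :: "'p padic_int"
  let ?p = "of_nat CARD('p) :: 'p padic_int" and ?G = "morita_prod CARD('p)"
  have prime: "prime CARD('p)" by (rule prime_card)
  obtain m where m: "x \<approx> of_nat m" unfolding sq_cong_def using ex_nat_near_padic[of 2 x] by blast
  have "int CARD('p) dvd ?G (m + 1 * CARD('p)) - ?G m"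
    using morita_prod_cong_mod_prime[OF prime odd, of m 1] by (simp only: cong_iff_dvd_diff)
  then obtain b where b: "?G (m + CARD('p)) - ?G m = int CARD('p) * b" by auto
  have "padic_Gamma (x + ?p * t) \<approx> padic_Gamma x + ?p * t * of_int b" for t
  proof -
    \<comment> \<open>Approximating \<open>t\<close> modulo \<open>p\<close> suffices, since
      \<open>t\<close> occurs only multiplied by \<open>p\<close>.\<close>
    obtain j where "?p ^ 1 dvd t - of_nat j" using ex_nat_near_padic[of 1 t] by blast
    then have "?p * ?p dvd ?p * (t - of_nat j)" by (intro mult_dvd_mono) simp_all
    then have t: "?p * t \<approx> ?p * of_nat j"
      unfolding sq_cong_def by (simp add: power2_eq_square algebra_simps)
    have "x + ?p * t \<approx> of_nat (m + j * CARD('p))"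
      using sq_cong_add[OF m t] by (simp add: mult.commute)
    then have "padic_Gamma (x + ?p * t) \<approx> of_int (?G (m + j * CARD('p)))"
      by (rule padic_Gamma_sq_cong[OF odd])
    also have "of_int (?G (m + j * CARD('p))) \<approx> (of_int (?G m + int j * (int CARD('p) * b)) :: 'p padic_int)"
      unfolding sq_cong_of_int using morita_prod_affine[OF prime odd, of m j] by (simp only: b)
    also have "of_int (?G m + int j * (int CARD('p) * b)) = of_int (?G m) + ?p * of_nat j * of_int b"
      by (simp add: mult_ac)
    also have "\<dots> \<approx> padic_Gamma x + ?p * t * of_int b"
      by (intro sq_cong_add sq_cong_mult sq_cong_refl sq_cong_sym[OF t]
          sq_cong_sym[OF padic_Gamma_sq_cong[OF odd m]])
    finally show ?thesis .
  qed
  then show "\<exists>B. \<forall>t. padic_Gamma (x + ?p * t) \<approx> padic_Gamma x + ?p * t * B" by blast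
qed

text \<open>The functional equation at units, obtained modulo \<open>p ^ 2\<close> by carrying
  \<open>morita_prod_Suc\<close> over from a natural number close to \<open>x\<close>.\<close>

lemma padic_Gamma_plus1:
  fixes x :: "'p :: prime_card padic_int"
  assumes odd: "odd CARD('p)" and unit: "\<not> of_nat CARD('p) dvd x"
  shows "padic_Gamma (x + 1) \<approx> - x * padic_Gamma x"
proof -
  obtain m where m: "x \<approx> of_nat m" unfolding sq_cong_def using ex_nat_near_padic[of 2 x] by blast
  have "\<not> CARD('p) dvd m"
  proof
    assume "CARD('p) dvd m"
    then have "(of_nat CARD('p) :: 'p padic_int) dvd of_nat m" by (auto elim!: dvdE)
    moreover have "of_nat CARD('p) dvd x - of_nat m"
      using m unfolding sq_cong_def power2_eq_square by (rule dvd_mult_left)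
    ultimately have "of_nat CARD('p) dvd (x - of_nat m) + of_nat m" by (rule dvd_add[rotated])
    then show False using unit by simp
  qed
  then have G: "morita_prod CARD('p) (Suc m) = - int m * morita_prod CARD('p) m"
    using morita_prod_Suc[OF prime_card[where 'a = 'p], of m] by simp
  have "x + 1 \<approx> of_nat m + 1" using m by (intro sq_cong_add) simp_all
  then have "x + 1 \<approx> of_nat (Suc m)" by (simp add: add.commute)
  then have "padic_Gamma (x + 1) \<approx> of_int (morita_prod CARD('p) (Suc m))"
    by (rule padic_Gamma_sq_cong[OF odd])
  also have "of_int (morita_prod CARD('p) (Suc m)) = - of_nat m * of_int (morita_prod CARD('p) m)"
    by (simp add: G)
  also have "\<dots> \<approx> - x * padic_Gamma x"
    by (intro sq_cong_mult sq_cong_minus sq_cong_sym[OF m] sq_cong_sym[OF padic_Gamma_sq_cong[OF odd m]])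
  finally show ?thesis .
qed

section \<open>The terminating series\<close>

text \<open>A division-free form of \<open>(1/2)_k = k! * binomial(2k, k) / 4^k\<close>. With
  \<open>h\<close> standing for one half it applies both to the reals and to the p-adic
  integers.\<close>

lemma pochhammer_half_central_binomial:
  fixes h :: "'a :: {comm_ring_1, ring_char_0}"
  assumes "2 * h = 1"
  shows "pochhammer h k = fact k * of_nat ((2 * k) choose k) * h ^ (2 * k)"
proof (induction k)
  case (Suc k)
  have c: "Suc k * ((2 * Suc k) choose Suc k) = 2 * (2 * k + 1) * ((2 * k) choose k)"
  proof -
    have "Suc k * ((2 * Suc k) choose Suc k) = (2 * Suc k) * (Suc (2 * k) choose k)"
      using Suc_times_binomial[of k "Suc (2 * k)"] by simp
    also have "\<dots> = 2 * (Suc k * (Suc (2 * k) choose Suc k))"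
      using binomial_symmetric[of k "Suc (2 * k)"] by simp
    also have "Suc k * (Suc (2 * k) choose Suc k) = Suc (2 * k) * ((2 * k) choose k)"
      by (rule Suc_times_binomial)
    finally show ?thesis by simp
  qed
  have "fact (Suc k) * of_nat ((2 * Suc k) choose Suc k) * h ^ (2 * Suc k) =
      fact k * of_nat (Suc k * ((2 * Suc k) choose Suc k)) * h ^ (2 * k) * h * h"
    unfolding mult_Suc_right[of 2 k] power_add power2_eq_square fact_Suc of_nat_mult
    by (simp only: mult_ac)
  also have "\<dots> = fact k * of_nat ((2 * k) choose k) * h ^ (2 * k) * ((2 * of_nat k + 1) * h) * (2 * h)"
    unfolding c by (simp only: of_nat_mult of_nat_add of_nat_numeral of_nat_1 mult_ac)
  also have "(2 * of_nat k + 1) * h = of_nat k * (2 * h) + h" by (simp add: algebra_simps)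
  also have "\<dots> = h + of_nat k" by (simp add: assms)
  finally show ?case using Suc assms by (simp add: pochhammer_Suc)
qed simp

lemma pochhammer_uminus_of_nat:
  "pochhammer (- of_nat n :: 'a :: {comm_ring_1, ring_char_0}) k = (-1) ^ k * fact k * of_nat (n choose k)"
proof (induction k)
  case (Suc k)
  have "(of_nat (n choose k) :: 'a) * (of_nat n - of_nat k) = of_nat (Suc k) * of_nat (n choose Suc k)"
  proof (cases "k \<le> n")
    case True
    have "Suc k * (n choose Suc k) = (n choose k) * (n - k)"
      using binomial_absorb_comp[of n k] binomial_absorption[of k n]
      by (cases n) (auto simp: Suc_times_binomial_eq mult.commute)
    then have "(of_nat (Suc k * (n choose Suc k)) :: 'a) = of_nat ((n choose k) * (n - k))" by simp
    then show ?thesis using True by (simp only: of_nat_mult of_nat_diff)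
  qed (simp add: binomial_eq_0)
  then have "(-1) ^ Suc k * fact (Suc k) * of_nat (n choose Suc k) =
      (-1) ^ Suc k * fact k * (of_nat (n choose k) * (of_nat n - of_nat k) :: 'a)"
    by (simp only: fact_Suc mult_ac)
  also have "\<dots> = ((-1) ^ k * fact k * of_nat (n choose k)) * (- of_nat n + of_nat k)"
    by (simp add: algebra_simps)
  finally show ?case by (simp only: Suc pochhammer_Suc)
qed simp

lemma pochhammer_of_nat_plus1:
  "pochhammer (of_nat n + 1 :: 'a :: {comm_ring_1, ring_char_0}) k = fact k * of_nat ((n + k) choose k)"
proof (induction k)
  case (Suc k)
  have "Suc k * ((n + Suc k) choose Suc k) = (n + Suc k) * ((n + k) choose k)"
    using Suc_times_binomial[of k "n + k"] by simp
  then have "(of_nat (Suc k * ((n + Suc k) choose Suc k)) :: 'a) = of_nat ((n + Suc k) * ((n + k) choose k))"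
    by (rule arg_cong)
  then have "(fact (Suc k) * of_nat ((n + Suc k) choose Suc k) :: 'a) =
      fact k * of_nat ((n + k) choose k) * (of_nat n + 1 + of_nat k)"
    by (simp only: fact_Suc of_nat_mult of_nat_add of_nat_Suc mult_ac add_ac)
  then show ?case by (simp only: Suc pochhammer_Suc)
qed simp

text \<open>The summand at \<open>a = n\<close> multiplied by \<open>4 ^ k\<close>. Being an
  integer, it carries the real evaluation over to the p-adic integers.\<close>

definition hyp_int :: "nat \<Rightarrow> nat \<Rightarrow> int" where
  "hyp_int n k = (-1) ^ k * int ((2 * k) choose k) * int (n choose k) * int ((n + k) choose k)"

lemma hyp_summand_conv_hyp_int:
  fixes h :: "'a :: {comm_ring_1, ring_char_0}"
  assumes "2 * h = 1"
  shows "pochhammer h k * pochhammer (- of_nat n) k * pochhammer (of_nat n + 1) k =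
    fact k ^ 3 * of_int (hyp_int n k) * h ^ (2 * k)"
  unfolding hyp_int_def pochhammer_half_central_binomial[OF assms] pochhammer_uminus_of_nat
    pochhammer_of_nat_plus1
  by (simp add: power3_eq_cube mult_ac)

section \<open>Evaluation of the terminating series over the reals\<close>

definition hyp_real :: "real \<Rightarrow> nat \<Rightarrow> real" where
  "hyp_real x k = pochhammer (1 / 2) k * pochhammer (- x) k * pochhammer (x + 1) k / fact k ^ 3"

lemma hyp_real_Suc:
  "hyp_real x (Suc k) * (real k + 1) ^ 3 = hyp_real x k * ((1/2 + k) * (k - x) * (x + 1 + k))"
  unfolding hyp_real_def pochhammer_Suc fact_Suc
  by (simp add: divide_simps power_mult_distrib) (simp add: algebra_simps)

text \<open>Four unit shifts of Pochhammer symbols relate the summands at \<open>x - 2\<close> and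
  \<open>x\<close>; \<open>x \<ge> 2\<close> makes the common factor \<open>x * (x - 1)\<close>
  nonzero, so it can be cancelled.\<close>

lemma hyp_real_shift:
  assumes "x \<ge> 2"
  shows "hyp_real (x - 2) k * ((x + k) * (x + k - 1)) = hyp_real x k * ((x - k) * (x - k - 1))"
proof -
  have shift: "pochhammer (a + 1) k * a = pochhammer a k * (a + k)" for a :: real
    using pochhammer_rec[of a k] by (simp add: pochhammer_Suc mult.commute)
  define P where "P a = pochhammer a k" for a :: real
  have 1: "P (1 - x) * (- x) = P (- x) * (k - x)" and 2: "P (2 - x) * (1 - x) = P (1 - x) * (1 - x + k)"
    and 3: "P x * (x - 1) = P (x - 1) * (x - 1 + k)" and 4: "P (x + 1) * x = P x * (x + k)"
    using shift[of "- x"] shift[of "1 - x"] shift[of "x - 1"] shift[of x] by (simp_all add: P_def)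
  have A: "P (2 - x) * (x * (x - 1)) = P (- x) * ((x - k) * (x - k - 1))"
  proof -
    have "P (2 - x) * (x * (x - 1)) = (P (2 - x) * (1 - x)) * (- x)" by (simp add: algebra_simps)
    also have "\<dots> = (P (1 - x) * (- x)) * (1 - x + k)" unfolding 2 by (simp only: mult_ac)
    also have "\<dots> = P (- x) * ((x - k) * (x - k - 1))" unfolding 1 by (simp add: algebra_simps)
    finally show ?thesis .
  qed
  have B: "P (x - 1) * ((x + k) * (x + k - 1)) = P (x + 1) * (x * (x - 1))"
  proof -
    have "P (x - 1) * ((x + k) * (x + k - 1)) = (P (x - 1) * (x - 1 + k)) * (x + k)"
      by (simp add: algebra_simps)
    also have "\<dots> = (P x * (x + k)) * (x - 1)" unfolding 3[symmetric] by (simp only: mult_ac)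
    also have "\<dots> = P (x + 1) * (x * (x - 1))" unfolding 4[symmetric] by (simp only: mult_ac)
    finally show ?thesis .
  qed
  have "(P (2 - x) * P (x - 1) * ((x + k) * (x + k - 1))) * (x * (x - 1)) =
      (P (- x) * P (x + 1) * ((x - k) * (x - k - 1))) * (x * (x - 1))"
  proof -
    have "(P (2 - x) * P (x - 1) * ((x + k) * (x + k - 1))) * (x * (x - 1)) =
        (P (2 - x) * (x * (x - 1))) * (P (x - 1) * ((x + k) * (x + k - 1)))" by (simp only: mult_ac)
    also have "\<dots> = (P (- x) * P (x + 1) * ((x - k) * (x - k - 1))) * (x * (x - 1))"
      unfolding A B by (simp only: mult_ac)
    finally show ?thesis .
  qed
  then have "P (2 - x) * P (x - 1) * ((x + k) * (x + k - 1)) = P (- x) * P (x + 1) * ((x - k) * (x - k - 1))"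
    using assms by simp
  then have "pochhammer (1 / 2) k / fact k ^ 3 * (P (2 - x) * P (x - 1) * ((x + k) * (x + k - 1))) =
      pochhammer (1 / 2) k / fact k ^ 3 * (P (- x) * P (x + 1) * ((x - k) * (x - k - 1)))" by simp
  moreover have "- (x - 2) = 2 - x" "x - 2 + 1 = x - 1" by simp_all
  ultimately show ?thesis unfolding hyp_real_def by (simp add: P_def mult_ac)
qed

text \<open>
  Zeilberger's algorithm finds the recurrence below, with the rational certificate
  \<open>- 2 * (2 * x - 1) * k ^ 3 / ((x + k) * (x + k - 1))\<close>.
\<close>

lemma hyp_real_telescope:
  fixes x :: real
  assumes "x \<ge> 2"
  shows "(\<Sum>k<K. x\<^sup>2 * hyp_real x k - (x - 1)\<^sup>2 * hyp_real (x - 2) k) =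
    - 2 * (2 * x - 1) * real K ^ 3 / ((x + K) * (x + K - 1)) * hyp_real x K"
proof (induction K)
  case (Suc K)
  define k where "k = real K"
  have pos: "x + k > 0" "x + k - 1 > 0" "x + k + 1 > 0" "k + 1 > 0" using assms by (auto simp: k_def)
  have S: "hyp_real x (Suc K) = hyp_real x K * ((1/2 + k) * (k - x) * (x + 1 + k)) / (k + 1) ^ 3"
    using hyp_real_Suc[of x K] pos by (simp add: k_def field_simps)
  have T: "hyp_real (x - 2) K = hyp_real x K * ((x - k) * (x - k - 1)) / ((x + k) * (x + k - 1))"
    using hyp_real_shift[OF assms, of K] pos by (simp add: k_def eq_divide_eq)
  \<comment> \<open>The polynomial identity that verifies the certificate: its right-hand side
    carries the factor \<open>(1/2 + k) * (k - x)\<close> of the ratio of consecutive summands, and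
    \<open>x + k - 1\<close> cancels against the denominator.\<close>
  have poly: "- 2 * (2 * x - 1) * k ^ 3 + (x\<^sup>2 * ((x + k) * (x + k - 1)) - (x - 1)\<^sup>2 * ((x - k) * (x - k - 1)))
      = - 2 * (2 * x - 1) * ((1/2 + k) * (k - x) * (x + k - 1))"
    by (simp add: field_simps power2_eq_square power3_eq_cube)
  have "(\<Sum>k<Suc K. x\<^sup>2 * hyp_real x k - (x - 1)\<^sup>2 * hyp_real (x - 2) k) =
     - 2 * (2 * x - 1) * k ^ 3 / ((x + k) * (x + k - 1)) * hyp_real x K +
     (x\<^sup>2 * hyp_real x K - (x - 1)\<^sup>2 * hyp_real (x - 2) K)"
    using Suc by (simp add: k_def)
  also have "\<dots> = hyp_real x K *
     (- 2 * (2 * x - 1) * k ^ 3 + (x\<^sup>2 * ((x + k) * (x + k - 1)) - (x - 1)\<^sup>2 * ((x - k) * (x - k - 1))))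
       / ((x + k) * (x + k - 1))"
    unfolding T using pos by (simp add: divide_simps) (simp add: algebra_simps)
  also have "\<dots> = - 2 * (2 * x - 1) * (k + 1) ^ 3 / ((x + (k + 1)) * (x + (k + 1) - 1)) * hyp_real x (Suc K)"
    unfolding poly S using pos by (simp add: divide_simps) (simp add: algebra_simps)
  finally show ?case by (simp add: k_def add_ac)
qed simp

lemma hyp_real_eq_0: "k > n \<Longrightarrow> hyp_real (real n) k = 0"
  using pochhammer_uminus_of_nat[of n k, where 'a = real] by (simp add: hyp_real_def)

text \<open>For \<open>K > x\<close> the boundary term of the telescoping sum vanishes, so
  \<open>x ^ 2\<close> times the sum at \<open>x\<close> is \<open>(x - 1) ^ 2\<close> times the sum
  at \<open>x - 2\<close>. Steps of 2 starting from \<open>x = 0\<close> reach the even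
  integers.\<close>

lemma sum_hyp_real_even:
  assumes "2 * s < K"
  shows "(\<Sum>k<K. hyp_real (real (2 * s)) k) = (pochhammer (1 / 2) s / fact s)\<^sup>2"
  using assms
proof (induction s)
  case 0
  have "(\<Sum>k<K. hyp_real (real (2 * 0)) k) = (\<Sum>k\<in>{0}. hyp_real 0 k)"
    using 0 hyp_real_eq_0[of 0] by (intro sum.mono_neutral_cong_right) auto
  then show ?case by (simp add: hyp_real_def)
next
  case (Suc s)
  define x where "x = real (2 * Suc s)"
  have x: "x \<ge> 2" "x - 2 = real (2 * s)" by (simp_all add: x_def)
  have "hyp_real x K = 0" unfolding x_def using Suc.prems by (intro hyp_real_eq_0)
  with hyp_real_telescope[OF x(1), of K]
  have "x\<^sup>2 * (\<Sum>k<K. hyp_real x k) = (x - 1)\<^sup>2 * (\<Sum>k<K. hyp_real (x - 2) k)"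
    by (simp add: sum_subtractf sum_distrib_left)
  also have "\<dots> = (x - 1)\<^sup>2 * (pochhammer (1 / 2) s / fact s)\<^sup>2"
    using Suc unfolding x(2) by simp
  also have "\<dots> = (pochhammer (1 / 2) s * (x - 1) / fact s)\<^sup>2" by (simp add: power_mult_distrib power_divide)
  also have "pochhammer (1 / 2) s * (x - 1) = 2 * pochhammer (1 / 2 :: real) (Suc s)"
    by (simp add: pochhammer_Suc x_def algebra_simps)
  also have "(2 * pochhammer (1 / 2 :: real) (Suc s) / fact s) = x * (pochhammer (1 / 2) (Suc s) / fact (Suc s))"
    by (simp add: x_def divide_simps)
  finally have "x\<^sup>2 * (\<Sum>k<K. hyp_real x k) = x\<^sup>2 * (pochhammer (1 / 2) (Suc s) / fact (Suc s))\<^sup>2"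
    by (simp only: power_mult_distrib)
  then show ?case using x(1) by (simp add: x_def)
qed

section \<open>Transfer of the evaluation to rings containing one half\<close>

lemma sum_hyp_int_even:
  "(\<Sum>k\<le>2 * s. hyp_int (2 * s) k * 4 ^ (2 * s - k)) = int ((2 * s) choose s) ^ 2"
proof -
  have half: "2 * (1 / 2 :: real) = 1" by simp
  have quarter: "(1 / 2 :: real) ^ (2 * k) = 1 / 4 ^ k" for k
    by (simp add: power_mult power_one_over power2_eq_square)
  \<comment> \<open>The denominator of the \<open>k\<close>-th summand is a power of 4, so
    multiplying the sum by \<open>4 ^ (2 * s)\<close> turns the evaluation into an identity of
    integers.\<close>
  have T: "hyp_real (real n) k = of_int (hyp_int n k) / 4 ^ k" for n k
    unfolding hyp_real_def hyp_summand_conv_hyp_int[OF half] quarter by simp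
  have "real_of_int (\<Sum>k\<le>2 * s. hyp_int (2 * s) k * 4 ^ (2 * s - k)) =
      (\<Sum>k\<le>2 * s. 4 ^ (2 * s) * hyp_real (real (2 * s)) k)"
    unfolding T of_int_sum
  proof (intro sum.cong refl)
    fix k assume "k \<in> {..2 * s}"
    then have "(4 :: real) ^ (2 * s - k) = 4 ^ (2 * s) / 4 ^ k" by (simp add: power_diff)
    then show "real_of_int (hyp_int (2 * s) k * 4 ^ (2 * s - k)) =
        4 ^ (2 * s) * (of_int (hyp_int (2 * s) k) / 4 ^ k)" by simp
  qed
  also have "\<dots> = 4 ^ (2 * s) * (\<Sum>k<Suc (2 * s). hyp_real (real (2 * s)) k)"
    by (simp only: sum_distrib_left lessThan_Suc_atMost)
  also have "(\<Sum>k<Suc (2 * s). hyp_real (real (2 * s)) k) = (real ((2 * s) choose s) / 4 ^ s)\<^sup>2"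
    unfolding sum_hyp_real_even[OF lessI] pochhammer_half_central_binomial[OF half] quarter by simp
  also have "4 ^ (2 * s) * (real ((2 * s) choose s) / 4 ^ s)\<^sup>2 = of_int (int ((2 * s) choose s) ^ 2)"
    by (simp add: power_divide power_mult[symmetric] mult.commute)
  finally show ?thesis by (simp only: of_int_eq_iff)
qed

lemma sum_hyp_even:
  fixes h :: "'a :: {comm_ring_1, ring_char_0}"
  assumes "2 * h = 1" "2 * s < K"
  shows "(\<Sum>k<K. of_int (hyp_int (2 * s) k) * h ^ (2 * k)) = (of_nat ((2 * s) choose s) * h ^ (2 * s)) ^ 2"
proof -
  have four: "4 ^ i * h ^ (2 * i) = 1" for i
  proof -
    have "4 * h\<^sup>2 = (2 * h)\<^sup>2" by (simp add: power2_eq_square)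
    then show ?thesis using assms(1) by (simp add: power_mult power_mult_distrib[symmetric])
  qed
  \<comment> \<open>Because \<open>4 * h ^ 2 = 1\<close>, all powers of \<open>h\<close> can be
    brought to the common factor \<open>h ^ (4 * s)\<close>, which matches the integer
    identity.\<close>
  have split: "h ^ (2 * k) = 4 ^ (2 * s - k) * (h ^ (2 * s))\<^sup>2" if "k \<le> 2 * s" for k
  proof -
    have "(h ^ (2 * s))\<^sup>2 = h ^ (2 * (2 * s - k)) * h ^ (2 * k)"
      using that by (simp flip: power_mult power_add add: add_mult_distrib2[symmetric])
    then show ?thesis using four[of "2 * s - k"] by (simp flip: mult.assoc)
  qed
  have "(\<Sum>k<K. of_int (hyp_int (2 * s) k) * h ^ (2 * k)) =
      (\<Sum>k\<le>2 * s. of_int (hyp_int (2 * s) k) * h ^ (2 * k))"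
    using assms(2) by (intro sum.mono_neutral_right) (auto simp: hyp_int_def binomial_eq_0)
  also have "\<dots> = (\<Sum>k\<le>2 * s. of_int (hyp_int (2 * s) k * 4 ^ (2 * s - k)) * (h ^ (2 * s))\<^sup>2)"
  proof (intro sum.cong refl)
    fix k assume "k \<in> {..2 * s}"
    then have "h ^ (2 * k) = 4 ^ (2 * s - k) * (h ^ (2 * s))\<^sup>2" by (intro split) simp
    then show "of_int (hyp_int (2 * s) k) * h ^ (2 * k) =
        of_int (hyp_int (2 * s) k * 4 ^ (2 * s - k)) * (h ^ (2 * s))\<^sup>2"
      by (simp only: of_int_mult of_int_power of_int_numeral mult.assoc)
  qed
  also have "\<dots> = of_int (\<Sum>k\<le>2 * s. hyp_int (2 * s) k * 4 ^ (2 * s - k)) * (h ^ (2 * s))\<^sup>2"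
    by (simp only: of_int_sum sum_distrib_right)
  also have "\<dots> = (of_nat ((2 * s) choose s) * h ^ (2 * s)) ^ 2"
    unfolding sum_hyp_int_even by (simp add: power_mult_distrib)
  finally show ?thesis .
qed

section \<open>Special values of the p-adic Gamma function\<close>

lemma prime_dvd_of_nat_padic_iff:
  "of_nat CARD('p) dvd (of_nat k :: 'p :: prime_card padic_int) \<longleftrightarrow> CARD('p) dvd k"
  using prime_power_dvd_padic_iff[of 1 "of_nat k :: 'p padic_int"]
  by (simp add: padic_mod_of_nat mod_eq_0_iff_dvd)

lemma of_nat_padic_unit':
  assumes "0 < k" "k < CARD('p)"
  shows "(of_nat k :: 'p :: prime_card padic_int) dvd 1"
proof (rule of_nat_padic_unit)
  have "\<not> CARD('p) dvd k" using assms by (auto dest: dvd_imp_le)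
  then show "coprime k CARD('p)"
    using prime_imp_coprime[OF prime_card[where 'a = 'p], of k] by (simp add: coprime_commute)
qed

lemma padic_Gamma_0: "odd CARD('p) \<Longrightarrow> padic_Gamma (0 :: 'p :: prime_card padic_int) \<approx> 1"
  using padic_Gamma_sq_cong[of "0 :: 'p padic_int" 0] by simp

lemma padic_Gamma_1: "odd CARD('p) \<Longrightarrow> padic_Gamma (1 :: 'p :: prime_card padic_int) \<approx> - 1"
  using padic_Gamma_sq_cong[of "1 :: 'p padic_int" "Suc 0"]
  by (simp add: morita_prod_Suc[OF prime_card[where 'a = 'p], of 0])

text \<open>Passing from \<open>x\<close> to \<open>x + 1\<close> multiplies the first factor by
  \<open>- x\<close> and divides the second by \<open>x\<close>, so each step only flips the sign.
  The bound on \<open>n\<close> keeps these \<open>x\<close> units.\<close>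

lemma padic_Gamma_reflection_nat:
  assumes odd: "odd CARD('p)" and "n < CARD('p)"
  shows "padic_Gamma (of_nat (Suc n)) * padic_Gamma (1 - of_nat (Suc n) :: 'p :: prime_card padic_int)
    \<approx> (-1) ^ Suc n"
  using assms(2)
proof (induction n)
  case 0
  show ?case using sq_cong_mult[OF padic_Gamma_1[OF odd] padic_Gamma_0[OF odd]] by simp
next
  case (Suc n)
  define x :: "'p padic_int" where "x = of_nat (Suc n)"
  have ndvd: "\<not> of_nat CARD('p) dvd x"
    unfolding x_def prime_dvd_of_nat_padic_iff using Suc.prems by (auto dest: dvd_imp_le)
  have g1: "padic_Gamma (x + 1) \<approx> - x * padic_Gamma x"
    by (rule padic_Gamma_plus1[OF odd ndvd])
  have g2: "padic_Gamma (1 - x) \<approx> x * padic_Gamma (- x)"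
    using padic_Gamma_plus1[OF odd, of "- x"] ndvd by simp
  have "x * (padic_Gamma (x + 1) * padic_Gamma (- x)) = padic_Gamma (x + 1) * (x * padic_Gamma (- x))"
    by (simp add: mult_ac)
  also have "\<dots> \<approx> (- x * padic_Gamma x) * padic_Gamma (1 - x)"
    by (intro sq_cong_mult g1 sq_cong_sym[OF g2])
  also have "\<dots> = x * - (padic_Gamma x * padic_Gamma (1 - x))" by (simp add: mult_ac)
  finally have "padic_Gamma (x + 1) * padic_Gamma (- x) \<approx> - (padic_Gamma x * padic_Gamma (1 - x))"
    by (rule sq_cong_cancel[rotated])
      (unfold x_def, rule of_nat_padic_unit', use Suc.prems in simp_all)
  also have "\<dots> \<approx> - ((-1) ^ Suc n)"
    unfolding x_def using Suc by (intro sq_cong_minus) simp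
  finally show ?case by (simp add: x_def add_ac)
qed

text \<open>The reflection product is known at the integer \<open>(p + 1) / 2 = h + p * h\<close>,
  which lies in the residue class of one half; its value there is moved to \<open>h\<close>
  itself.\<close>

lemma padic_Gamma_half_squared:
  fixes h :: "'p :: prime_card padic_int"
  assumes odd: "odd CARD('p)" and h: "2 * h = 1"
  shows "padic_Gamma h ^ 2 \<approx> (-1) ^ ((CARD('p) + 1) div 2)"
proof -
  let ?p = "of_nat CARD('p) :: 'p padic_int"
  define n where "n = CARD('p) div 2"
  have n: "CARD('p) = 2 * n + 1" "Suc n = (CARD('p) + 1) div 2" "n < CARD('p)"
    using odd by (auto simp: n_def elim!: oddE)
  define \<phi> where "\<phi> x = padic_Gamma x * padic_Gamma (1 - x)" for x :: "'p padic_int"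
  have \<phi>_reflect: "\<phi> (1 - x) = \<phi> x" for x by (simp add: \<phi>_def mult.commute)
  have hh: "1 - h = h" using h by (simp add: algebra_simps mult_2)
  have "affine_mod_sq (\<lambda>x :: 'p padic_int. padic_Gamma (-1 * x + 1))"
    by (intro affine_mod_sq_compose_linear affine_mod_sq_padic_Gamma odd)
  then have "affine_mod_sq \<phi>"
    unfolding \<phi>_def by (intro affine_mod_sq_mult affine_mod_sq_padic_Gamma odd) simp
  then obtain B where B: "\<And>t. \<phi> (h + ?p * t) \<approx> \<phi> h + ?p * t * B"
    unfolding affine_mod_sq_def by blast
  \<comment> \<open>\<open>\<phi>\<close> is symmetric about \<open>1/2\<close>, hence its slope there vanishes modulo \<open>p\<^sup>2\<close>.\<close>
  have "1 - (h + ?p * h) = h + ?p * (- h)" using hh by (simp add: algebra_simps)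
  then have sym: "\<phi> (h + ?p * (- h)) = \<phi> (h + ?p * h)"
    using \<phi>_reflect[of "h + ?p * h"] by (simp only:)
  have "\<phi> (h + ?p * h) - \<phi> (h + ?p * (- h)) \<approx> (\<phi> h + ?p * h * B) - (\<phi> h + ?p * (- h) * B)"
    by (intro sq_cong_diff B)
  also have "\<dots> = (2 * h) * (?p * B)" by (simp add: algebra_simps mult_2)
  finally have "0 \<approx> ?p * B" by (simp only: sym h diff_self mult_1)
  then have "?p * B \<approx> 0" by (rule sq_cong_sym)
  then have "\<phi> h + h * (?p * B) \<approx> \<phi> h + h * 0" by (intro sq_cong_add sq_cong_mult sq_cong_refl)
  then have "\<phi> (h + ?p * h) \<approx> \<phi> h"
    using B[of h] sq_cong_trans by (simp add: mult_ac)
  moreover have "h + ?p * h = of_nat (Suc n)"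
  proof -
    have "h + ?p * h = (2 * h) * of_nat (Suc n)" unfolding n(1) by (simp add: algebra_simps mult_2)
    then show ?thesis by (simp add: h)
  qed
  moreover have "\<phi> (of_nat (Suc n)) \<approx> (-1) ^ Suc n"
    unfolding \<phi>_def by (rule padic_Gamma_reflection_nat[OF odd n(3)])
  ultimately have "\<phi> h \<approx> (-1) ^ Suc n" by (metis sq_cong_sym sq_cong_trans)
  then show ?thesis unfolding \<phi>_def hh n(2) by (simp add: power2_eq_square)
qed

lemma fact_mult_padic_Gamma_minus_nat:
  assumes odd: "odd CARD('p)" and "s < CARD('p)"
  shows "fact s * padic_Gamma (- of_nat s :: 'p :: prime_card padic_int) \<approx> 1"
  using assms(2)
proof (induction s)
  case 0
  show ?case using padic_Gamma_0[OF odd] by simp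
next
  case (Suc s)
  define x :: "'p padic_int" where "x = of_nat (Suc s)"
  have "\<not> of_nat CARD('p) dvd - x"
    unfolding x_def dvd_minus_iff prime_dvd_of_nat_padic_iff using Suc.prems by (auto dest: dvd_imp_le)
  from padic_Gamma_plus1[OF odd this]
  have "padic_Gamma (- of_nat s :: 'p padic_int) \<approx> x * padic_Gamma (- x)"
    by (simp add: x_def add.commute)
  then have "fact s * (x * padic_Gamma (- x)) \<approx> fact s * padic_Gamma (- of_nat s :: 'p padic_int)"
    by (intro sq_cong_mult sq_cong_refl) (rule sq_cong_sym)
  also have "\<dots> \<approx> 1" using Suc by simp
  finally show ?case by (simp only: fact_Suc x_def mult_ac)
qed

lemma padic_Gamma_half_plus_nat:
  fixes h :: "'p :: prime_card padic_int"
  assumes odd: "odd CARD('p)" and h: "2 * h = 1" and "2 * s < CARD('p)"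
  shows "padic_Gamma (h + of_nat s) \<approx> (-1) ^ s * pochhammer h s * padic_Gamma h"
  using assms(3)
proof (induction s)
  case (Suc s)
  have "\<not> of_nat CARD('p) dvd h + of_nat s"
  proof
    assume "of_nat CARD('p) dvd h + of_nat s"
    \<comment> \<open>Doubling turns \<open>h + s\<close> into the natural number
      \<open>2 * s + 1\<close>, which lies strictly between 0 and \<open>p\<close>.\<close>
    then have "of_nat CARD('p) dvd 2 * (h + of_nat s)" by (rule dvd_mult)
    also have "2 * (h + of_nat s) = of_nat (2 * s + 1)" by (simp add: distrib_left h)
    finally have "CARD('p) dvd 2 * s + 1" by (simp only: prime_dvd_of_nat_padic_iff)
    then show False using Suc.prems by (auto dest: dvd_imp_le)
  qed
  from padic_Gamma_plus1[OF odd this]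
  have "padic_Gamma (h + of_nat (Suc s)) \<approx> - (h + of_nat s) * padic_Gamma (h + of_nat s)"
    by (simp add: add_ac)
  also have "\<dots> \<approx> - (h + of_nat s) * ((-1) ^ s * pochhammer h s * padic_Gamma h)"
    using Suc by (intro sq_cong_mult sq_cong_refl) simp
  also have "\<dots> = (-1) ^ Suc s * pochhammer h (Suc s) * padic_Gamma h"
    by (simp add: pochhammer_Suc algebra_simps)
  finally show ?case .
qed simp

text \<open>The factorial in \<open>pochhammer h s\<close> cancels against the value at
  \<open>- s\<close>, and squaring removes the sign, leaving the central binomial term and the
  square of the value at one half.\<close>

lemma padic_Gamma_product_even:
  fixes h :: "'p :: prime_card padic_int"
  assumes odd: "odd CARD('p)" and h: "2 * h = 1" and s: "2 * s < CARD('p)"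
  shows "padic_Gamma (- of_nat s) ^ 2 * padic_Gamma (h + of_nat s) ^ 2 \<approx>
    (of_nat ((2 * s) choose s) * h ^ (2 * s)) ^ 2 * (-1) ^ ((CARD('p) + 1) div 2)"
proof -
  let ?c = "of_nat ((2 * s) choose s) * h ^ (2 * s)"
  have "padic_Gamma (- of_nat s) ^ 2 * padic_Gamma (h + of_nat s) ^ 2 \<approx>
      padic_Gamma (- of_nat s) ^ 2 * ((-1) ^ s * pochhammer h s * padic_Gamma h) ^ 2"
    by (intro sq_cong_mult sq_cong_refl sq_cong_power padic_Gamma_half_plus_nat[OF odd h s])
  also have "\<dots> = (fact s * padic_Gamma (- of_nat s)) ^ 2 * (?c ^ 2 * padic_Gamma h ^ 2)"
  proof -
    have "((-1 :: 'p padic_int) ^ s)\<^sup>2 = 1" by (simp flip: power_mult)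
    then show ?thesis
      unfolding pochhammer_half_central_binomial[OF h] power_mult_distrib by (simp add: mult_ac)
  qed
  also have "\<dots> \<approx> 1 ^ 2 * (?c ^ 2 * (-1) ^ ((CARD('p) + 1) div 2))"
    using s by (intro sq_cong_mult sq_cong_refl sq_cong_power padic_Gamma_half_squared[OF odd h]
        fact_mult_padic_Gamma_minus_nat[OF odd]) simp
  finally show ?thesis by simp
qed

section \<open>The truncated series\<close>

definition truncated_hyp :: "'p :: prime_card padic_int \<Rightarrow> 'p padic_int" where
  "truncated_hyp a = (\<Sum>k=0..CARD('p) - 1.
     pochhammer (1 / 2) k * pochhammer (- a) k * pochhammer (a + 1) k
       / (pochhammer 1 k * pochhammer 1 k) * (1 / fact k))"

text \<open>The substitution interchanges \<open>pochhammer (- a) k\<close> and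
  \<open>pochhammer (a + 1) k\<close>.\<close>

lemma truncated_hyp_reflect: "truncated_hyp (- 1 - a) = truncated_hyp a"
  unfolding truncated_hyp_def by (intro sum.cong refl) (simp add: mult_ac add.commute)

text \<open>The denominators do not involve \<open>a\<close>; once division is unfolded, their
  inverses are constants and the sum is a polynomial in \<open>a\<close>.\<close>

lemma affine_mod_sq_truncated_hyp:
  "affine_mod_sq (truncated_hyp :: 'p :: prime_card padic_int \<Rightarrow> 'p padic_int)"
  unfolding truncated_hyp_def divide_padic_int_def
  by (intro affine_mod_sq_sum affine_mod_sq_mult affine_mod_sq_const affine_mod_sq_pochhammer
      affine_mod_sq_add affine_mod_sq_uminus affine_mod_sq_id)

lemma fact_padic_unit:
  assumes "k < CARD('p)"
  shows "(fact k :: 'p :: prime_card padic_int) dvd 1"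
  using assms
proof (induction k)
  case (Suc k)
  then have "(of_nat (Suc k) :: 'p padic_int) * fact k dvd 1 * 1"
    by (intro mult_dvd_mono of_nat_padic_unit') auto
  then show ?case by (simp only: fact_Suc mult_1)
qed simp

lemma truncated_hyp_even:
  fixes h :: "'p :: prime_card padic_int"
  assumes s: "2 * s < CARD('p)" and h: "h = 1 / 2" "2 * h = 1"
  shows "truncated_hyp (of_nat (2 * s)) = (of_nat ((2 * s) choose s) * h ^ (2 * s)) ^ 2"
proof -
  have "truncated_hyp (of_nat (2 * s)) = (\<Sum>k<CARD('p). of_int (hyp_int (2 * s) k) * h ^ (2 * k))"
    unfolding truncated_hyp_def
  proof (rule sum.cong)
    show "{0..CARD('p) - 1} = {..<CARD('p)}"
      using s by auto
    fix k assume "k \<in> {..<CARD('p)}"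
    \<comment> \<open>For \<open>k < p\<close> the factorials are units, so these divisions are
      genuine and the default value 0 of \<open>inverse\<close> does not occur.\<close>
    then have u: "(fact k :: 'p padic_int) dvd 1" by (intro fact_padic_unit) simp
    have u2: "(fact k * fact k :: 'p padic_int) dvd 1" using mult_dvd_mono[OF u u] by simp
    define d e :: "'p padic_int" where "d = inverse (fact k)" and "e = inverse (fact k * fact k)"
    have d: "fact k * d = 1" and e: "fact k * fact k * e = 1"
      unfolding d_def e_def by (rule padic_mult_inverse[OF u] padic_mult_inverse[OF u2])+
    let ?x = "of_int (hyp_int (2 * s) k) * h ^ (2 * k)"
    have "pochhammer (1 / 2) k * pochhammer (- of_nat (2 * s)) k * pochhammer (of_nat (2 * s) + 1) k
        / (pochhammer 1 k * pochhammer 1 k) * (1 / fact k) = (fact k ^ 3 * ?x) * e * d"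
      unfolding h(1)[symmetric] hyp_summand_conv_hyp_int[OF h(2)] pochhammer_fact[symmetric]
      by (simp only: divide_padic_int_def d_def e_def mult_1 mult.assoc)
    also have "\<dots> = ?x * (fact k * fact k * e) * (fact k * d)"
      by (simp add: power3_eq_cube mult_ac)
    also have "\<dots> = ?x" by (simp add: d e)
    finally show "pochhammer (1 / 2) k * pochhammer (- of_nat (2 * s)) k * pochhammer (of_nat (2 * s) + 1) k
        / (pochhammer 1 k * pochhammer 1 k) * (1 / fact k) = ?x" .
  qed
  then show ?thesis using sum_hyp_even[OF h(2) s] by simp
qed

section \<open>From even integers to the whole residue class of \<open>a\<close>\<close>

lemma padic_residue_props:
  fixes a :: "'p :: prime_card padic_int"
  shows "of_nat CARD('p) dvd a - of_nat (padic_residue a)" "padic_residue a < CARD('p)"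
proof -
  let ?P = "\<lambda>r. of_nat CARD('p) dvd a - of_nat r"
  have "\<exists>r. ?P r" using ex_nat_near_padic[of 1 a] by simp
  then show P: "?P (padic_residue a)" unfolding padic_residue_def by (rule LeastI_ex)
  show "padic_residue a < CARD('p)"
  proof (rule ccontr)
    assume "\<not> padic_residue a < CARD('p)"
    then have le: "CARD('p) \<le> padic_residue a" by simp
    have "a - of_nat (padic_residue a - CARD('p)) = (a - of_nat (padic_residue a)) + of_nat CARD('p)"
      using le by (simp add: of_nat_diff)
    then have "?P (padic_residue a - CARD('p))" using P by (simp only:) (rule dvd_add, simp_all)
    then have "padic_residue a \<le> padic_residue a - CARD('p)"
      unfolding padic_residue_def by (rule Least_le)
    moreover have "CARD('p) > 0" using card_prime_pos[where 'p = 'p] by simp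
    ultimately show False using le by linarith
  qed
qed

theorem theorem2:
  fixes p :: nat and a :: "'p :: prime_card padic_int"
  assumes "p = CARD('p)" and "p \<ge> 5" and "even (padic_residue a)"
  shows "of_nat p ^ 2 dvd
    (\<Sum>k=0..p - 1. pochhammer (1 / 2) k * pochhammer (- a) k * pochhammer (a + 1) k
        / (pochhammer 1 k * pochhammer 1 k) * (1 / fact k))
    - (-1) ^ ((p + 1) div 2) * padic_Gamma (- a / 2) ^ 2 * padic_Gamma ((a + 1) / 2) ^ 2"
proof -
  let ?p = "of_nat CARD('p) :: 'p padic_int"
  define \<epsilon> :: "'p padic_int" where "\<epsilon> = (-1) ^ ((CARD('p) + 1) div 2)"
  have odd: "odd CARD('p)"
    using prime_odd_nat[OF prime_card[where 'a = 'p]] assms(1,2) by simp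
  define h :: "'p padic_int" where "h = 1 / 2"
  have "(2 :: 'p padic_int) dvd 1"
    using of_nat_padic_unit'[of 2, where 'p = 'p] assms(1,2) by simp
  then have h: "2 * h = 1" unfolding h_def divide_padic_int_def by (simp add: padic_mult_inverse)
  have half: "x / 2 = h * x" for x :: "'p padic_int"
    by (simp add: h_def divide_padic_int_def mult.commute)
  \<comment> \<open>The difference of the two sides; the goal is that it vanishes modulo
    \<open>p ^ 2\<close> at \<open>a\<close>.\<close>
  define F where "F x = truncated_hyp x - \<epsilon> * padic_Gamma (- x / 2) ^ 2 * padic_Gamma ((x + 1) / 2) ^ 2"
    for x :: "'p padic_int"
  have "affine_mod_sq (\<lambda>x. padic_Gamma (- h * x + 0))" "affine_mod_sq (\<lambda>x. padic_Gamma (h * x + h))"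
    by (intro affine_mod_sq_compose_linear affine_mod_sq_padic_Gamma odd)+
  then have "affine_mod_sq F"
    unfolding F_def half
    by (intro affine_mod_sq_diff affine_mod_sq_mult affine_mod_sq_power affine_mod_sq_const
        affine_mod_sq_truncated_hyp) (simp_all add: distrib_left)
  then obtain B where B: "\<And>t. F (of_nat (padic_residue a) + ?p * t) \<approx> F (of_nat (padic_residue a)) + ?p * t * B"
    unfolding affine_mod_sq_def by blast
  \<comment> \<open>Besides fixing the series, the reflection interchanges the Gamma arguments
    \<open>- x / 2\<close> and \<open>(x + 1) / 2\<close>.\<close>
  have reflect: "F (- 1 - x) = F x" for x
    unfolding F_def truncated_hyp_reflect by (simp add: mult_ac add.commute)
  have even: "F (of_nat r) \<approx> 0" if "even r" "r < CARD('p)" for r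
  proof -
    from that obtain s where s: "r = 2 * s" "2 * s < CARD('p)" by (auto elim!: evenE)
    let ?c = "of_nat ((2 * s) choose s) * h ^ (2 * s)"
    have args: "- of_nat r / 2 = (- of_nat s :: 'p padic_int)" "(of_nat r + 1) / 2 = h + of_nat s"
    proof -
      have "h * of_nat r = (2 * h) * of_nat s" by (simp add: s(1) mult_ac)
      then have "h * of_nat r = of_nat s" by (simp add: h)
      then show "- of_nat r / 2 = (- of_nat s :: 'p padic_int)" "(of_nat r + 1) / 2 = h + of_nat s"
        unfolding half by (simp_all add: distrib_left)
    qed
    have "\<epsilon> * (padic_Gamma (- of_nat s) ^ 2 * padic_Gamma (h + of_nat s) ^ 2) \<approx> \<epsilon> * (?c ^ 2 * \<epsilon>)"
      unfolding \<epsilon>_def by (intro sq_cong_mult sq_cong_refl padic_Gamma_product_even[OF odd h s(2)])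
    \<comment> \<open>The sign in the theorem cancels the sign coming from the square of the Gamma
      value at one half.\<close>
    moreover have "\<epsilon> * \<epsilon> = 1" by (simp add: \<epsilon>_def flip: power_add mult_2)
    then have "\<epsilon> * (?c ^ 2 * \<epsilon>) = ?c ^ 2" by (simp add: mult_ac flip: mult.assoc)
    ultimately have "?c ^ 2 - \<epsilon> * (padic_Gamma (- of_nat s) ^ 2 * padic_Gamma (h + of_nat s) ^ 2) \<approx>
        ?c ^ 2 - ?c ^ 2"
      by (intro sq_cong_diff) simp_all
    then show ?thesis
      unfolding F_def args using truncated_hyp_even[OF s(2) h_def h] by (simp add: s(1) mult_ac)
  qed
  define r where "r = padic_residue a"
  have r: "even r" "r < CARD('p)" "?p dvd a - of_nat r"
    using assms(3) padic_residue_props[of a] by (simp_all add: r_def)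
  have Fr: "F (of_nat r) \<approx> 0" by (intro even r)
  \<comment> \<open>The second zero of \<open>F\<close> in the class is \<open>r - p\<close>: it is
    the reflection of \<open>p - 1 - r\<close>, which is even because \<open>p\<close> is odd and
    \<open>r\<close> is even.\<close>
  have "- 1 - of_nat (CARD('p) - 1 - r) = of_nat r + ?p * (- 1)"
    using r(2) by (simp add: of_nat_diff)
  then have "F (of_nat r + ?p * (- 1)) = F (of_nat (CARD('p) - 1 - r))" by (metis reflect)
  moreover have "F (of_nat (CARD('p) - 1 - r)) \<approx> 0"
    using r odd by (intro even) auto
  ultimately have "F (of_nat r) - F (of_nat r + ?p * (- 1)) \<approx> 0 - 0"
    using Fr by (intro sq_cong_diff) simp_all
  moreover have "F (of_nat r) - F (of_nat r + ?p * (- 1)) \<approx> F (of_nat r) - (F (of_nat r) + ?p * (- 1) * B)"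
    using B[of "- 1"] by (intro sq_cong_diff sq_cong_refl) (simp only: r_def)
  ultimately have "F (of_nat r) - (F (of_nat r) + ?p * (- 1) * B) \<approx> 0 - 0"
    by (metis sq_cong_sym sq_cong_trans)
  \<comment> \<open>Two zeros one step of size \<open>p\<close> apart force the slope term to vanish
    modulo \<open>p ^ 2\<close>.\<close>
  then have pB: "?p * B \<approx> 0" by simp
  obtain t where t: "a = of_nat r + ?p * t" using r(3) by (auto simp: algebra_simps elim!: dvdE)
  have "F a \<approx> F (of_nat r) + ?p * t * B" unfolding t using B[of t] by (simp only: r_def)
  also have "F (of_nat r) + ?p * t * B = F (of_nat r) + t * (?p * B)" by (simp add: mult_ac)
  also have "\<dots> \<approx> 0 + t * 0" by (intro sq_cong_add sq_cong_mult sq_cong_refl pB Fr)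
  finally have "F a \<approx> 0" by simp
  then show ?thesis
    unfolding sq_cong_def F_def truncated_hyp_def \<epsilon>_def by (simp add: assms(1))
qed


end
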